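(* Let $T$ be a 2-3 tree and let $S$ be an ordered slice of $T$ containing $k$ leaves. Then the subtrees in $S$ can be joined into a single 2-3 tree whose leaves are those of $S$ in the same left-to-right order, in $O(\log k)$ sequential time (as $k\to\infty$).
   Context: A 2-3 tree is a rooted tree whose leaves are all at the same depth and whose internal nodes each have $2$ or $3$ ordered children; items are stored at the leaves. A 2-3 subtree of $T$ is a node of $T$ together with all its descendants. A slice of $T$ is a minimal-length sequence of pairwise disjoint 2-3 subtrees of $T$ whose leaves together form a set of consecutive leaves of $T$. An ordered slice is a slice whose subtrees are listed in left-to-right order in $T$. *)

theory Defs
  imports Complex_Main "HOL-Library.Sublist" "HOL-Library.Landau_Symbols"
begin

section \<open>2-3 trees\<close>

datatype 'a tree23 =
    Leaf 'a
  | Node2 "'a tree23" "'a tree23"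
  | Node3 "'a tree23" "'a tree23" "'a tree23"

fun children :: "'a tree23 \<Rightarrow> 'a tree23 list" where
  "children (Leaf x) = []"
| "children (Node2 l r) = [l, r]"
| "children (Node3 l m r) = [l, m, r]"

fun height :: "'a tree23 \<Rightarrow> nat" where
  "height (Leaf x) = 0"
| "height (Node2 l r) = Suc (max (height l) (height r))"
| "height (Node3 l m r) = Suc (max (height l) (max (height m) (height r)))"

fun items :: "'a tree23 \<Rightarrow> 'a list" where
  "items (Leaf x) = [x]"
| "items (Node2 l r) = items l @ items r"
| "items (Node3 l m r) = items l @ items m @ items r"

text \<open>A node of a tree is given by its position: the list of child indices on the path from the
  root, so that different nodes stay different even if their subtrees are equal as terms.\<close>

type_synonym pos = "nat list"

fun nodes :: "'a tree23 \<Rightarrow> pos set" where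
  "nodes (Leaf x) = {[]}"
| "nodes (Node2 l r) = {[]} \<union> (#) 0 ` nodes l \<union> (#) 1 ` nodes r"
| "nodes (Node3 l m r) = {[]} \<union> (#) 0 ` nodes l \<union> (#) 1 ` nodes m \<union> (#) 2 ` nodes r"

text \<open>The positions of the leaves, from left to right.\<close>

fun leaves :: "'a tree23 \<Rightarrow> pos list" where
  "leaves (Leaf x) = [[]]"
| "leaves (Node2 l r) = map ((#) 0) (leaves l) @ map ((#) 1) (leaves r)"
| "leaves (Node3 l m r) =
     map ((#) 0) (leaves l) @ map ((#) 1) (leaves m) @ map ((#) 2) (leaves r)"

fun subtree :: "'a tree23 \<Rightarrow> pos \<Rightarrow> 'a tree23" where
  "subtree T [] = T"
| "subtree T (i # p) = subtree (children T ! i) p"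

text \<open>The datatype does not force equal depths; the depth of a leaf is the length of its position.\<close>

definition is_tree23 :: "'a tree23 \<Rightarrow> bool" where
  "is_tree23 T \<longleftrightarrow> (\<exists>d. \<forall>p \<in> set (leaves T). length p = d)"


section \<open>Slices\<close>

text \<open>A 2-3 subtree of \<open>T\<close> is represented by the position of its root in \<open>T\<close>.\<close>

definition descendants :: "'a tree23 \<Rightarrow> pos \<Rightarrow> pos set" where
  "descendants T p = {q \<in> nodes T. prefix p q}"

definition leaves_below :: "'a tree23 \<Rightarrow> pos \<Rightarrow> pos set" where
  "leaves_below T p = {q \<in> set (leaves T). prefix p q}"

definition disjoint_subtrees :: "'a tree23 \<Rightarrow> pos list \<Rightarrow> bool" where
  "disjoint_subtrees T S \<longleftrightarrow> set S \<subseteq> nodes T \<and>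
     (\<forall>i < length S. \<forall>j < length S. i \<noteq> j \<longrightarrow>
        descendants T (S ! i) \<inter> descendants T (S ! j) = {})"

definition leaves_of :: "'a tree23 \<Rightarrow> pos list \<Rightarrow> pos set" where
  "leaves_of T S = (\<Union>p \<in> set S. leaves_below T p)"

definition consecutive_leaves :: "'a tree23 \<Rightarrow> pos set \<Rightarrow> bool" where
  "consecutive_leaves T L \<longleftrightarrow> (\<exists>i n. L = set (take n (drop i (leaves T))))"

text \<open>Minimality is among the sequences of disjoint subtrees with the same set of leaves.\<close>

definition is_slice :: "'a tree23 \<Rightarrow> pos list \<Rightarrow> bool" where
  "is_slice T S \<longleftrightarrow> disjoint_subtrees T S \<and> consecutive_leaves T (leaves_of T S) \<and>
     (\<forall>S'. disjoint_subtrees T S' \<and> leaves_of T S' = leaves_of T S \<longrightarrow> length S \<le> length S')"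

definition leaf_before :: "'a tree23 \<Rightarrow> pos \<Rightarrow> pos \<Rightarrow> bool" where
  "leaf_before T u v \<longleftrightarrow>
     (\<exists>i j. i < j \<and> j < length (leaves T) \<and> leaves T ! i = u \<and> leaves T ! j = v)"

definition left_of :: "'a tree23 \<Rightarrow> pos \<Rightarrow> pos \<Rightarrow> bool" where
  "left_of T p q \<longleftrightarrow> (\<forall>u \<in> leaves_below T p. \<forall>v \<in> leaves_below T q. leaf_before T u v)"

definition is_ordered_slice :: "'a tree23 \<Rightarrow> pos list \<Rightarrow> bool" where
  "is_ordered_slice T S \<longleftrightarrow> is_slice T S \<and> sorted_wrt (left_of T) S"


section \<open>Sequential time\<close>

text \<open>Sequential algorithms are while-programs for a random-access machine: finitely many
  registers are used by a program, the memory is indexed by the natural numbers, and every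
  elementary operation and every test takes one time step. There is no multiplication, so that the
  unit cost of arithmetic is the usual one. Subtraction is truncated at zero.\<close>

type_synonym reg = nat

datatype com =
    Skip
  | SetConst reg nat
  | Copy reg reg
  | Add reg reg reg
  | Sub reg reg reg
  | Load reg reg
  | Store reg reg
  | Seq com com
  | IfLess reg reg com com
  | WhileLess reg reg com

record state =
  regs :: "reg \<Rightarrow> nat"
  mem :: "nat \<Rightarrow> nat"

definition set_reg :: "reg \<Rightarrow> nat \<Rightarrow> state \<Rightarrow> state" where
  "set_reg a v s = s\<lparr>regs := (regs s)(a := v)\<rparr>"

definition set_mem :: "nat \<Rightarrow> nat \<Rightarrow> state \<Rightarrow> state" where
  "set_mem x v s = s\<lparr>mem := (mem s)(x := v)\<rparr>"

text \<open>\<open>exec c s t s'\<close>: started in \<open>s\<close>, program \<open>c\<close> halts in \<open>s'\<close> after exactly \<open>t\<close> time steps.\<close>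

inductive exec :: "com \<Rightarrow> state \<Rightarrow> nat \<Rightarrow> state \<Rightarrow> bool" where
  Skip: "exec Skip s 1 s"
| SetConst: "exec (SetConst a n) s 1 (set_reg a n s)"
| Copy: "exec (Copy a b) s 1 (set_reg a (regs s b) s)"
| Add: "exec (Add a b c) s 1 (set_reg a (regs s b + regs s c) s)"
| Sub: "exec (Sub a b c) s 1 (set_reg a (regs s b - regs s c) s)"
| Load: "exec (Load a b) s 1 (set_reg a (mem s (regs s b)) s)"
| Store: "exec (Store a b) s 1 (set_mem (regs s a) (regs s b) s)"
| Seq: "exec c1 s t1 s1 \<Longrightarrow> exec c2 s1 t2 s2 \<Longrightarrow> exec (Seq c1 c2) s (t1 + t2) s2"
| IfTrue: "regs s a < regs s b \<Longrightarrow> exec c1 s t s' \<Longrightarrow> exec (IfLess a b c1 c2) s (1 + t) s'"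
| IfFalse: "\<not> regs s a < regs s b \<Longrightarrow> exec c2 s t s' \<Longrightarrow> exec (IfLess a b c1 c2) s (1 + t) s'"
| WhileFalse: "\<not> regs s a < regs s b \<Longrightarrow> exec (WhileLess a b c) s 1 s"
| WhileTrue: "regs s a < regs s b \<Longrightarrow> exec c s t1 s1 \<Longrightarrow> exec (WhileLess a b c) s1 t2 s2 \<Longrightarrow>
    exec (WhileLess a b c) s (1 + t1 + t2) s2"

lemma exec_deterministic:
  "exec c s t s' \<Longrightarrow> exec c s u s'' \<Longrightarrow> u = t \<and> s'' = s'"
proof (induction arbitrary: u s'' rule: exec.induct)
  case (Seq c1 s t1 s1 c2 t2 s2)
  from Seq.prems show ?case by (cases rule: exec.cases) (use Seq.IH in blast)+
next
  case (IfTrue s a b c1 t s' c2)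
  from IfTrue.prems show ?case by (cases rule: exec.cases) (use IfTrue in blast)+
next
  case (IfFalse s a b c2 t s' c1)
  from IfFalse.prems show ?case by (cases rule: exec.cases) (use IfFalse in blast)+
next
  case (WhileFalse s a b c)
  from WhileFalse.prems show ?case by (cases rule: exec.cases) (use WhileFalse in blast)+
next
  case (WhileTrue s a b c t1 s1 t2 s2)
  from WhileTrue.prems show ?case by (cases rule: exec.cases) (use WhileTrue in blast)+
qed (erule exec.cases; simp)+


section \<open>Trees and slices in memory\<close>

text \<open>\<open>stored m item f x T\<close>: in memory \<open>m\<close>, the tree \<open>T\<close> is stored as a linked structure with root
  record at address \<open>x\<close>, all of it below address \<open>f\<close>. The record of an internal node consists of
  its height, its number of children and the addresses of the children; that of a leaf is a \<open>0\<close>.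
  With child pointers alone, finding the heights of all trees of a slice may take more than
  logarithmic time, so the heights are part of the data structure.
  The item of a leaf is opaque to the machine and is attached to the address of the leaf by
  \<open>item\<close>, which programs cannot change.\<close>

fun stored :: "(nat \<Rightarrow> nat) \<Rightarrow> (nat \<Rightarrow> 'a) \<Rightarrow> nat \<Rightarrow> nat \<Rightarrow> 'a tree23 \<Rightarrow> bool" where
  "stored m item f x (Leaf a) \<longleftrightarrow> x < f \<and> m x = 0 \<and> item x = a"
| "stored m item f x (Node2 t0 t1) \<longleftrightarrow> x + 3 < f \<and>
     m x = height (Node2 t0 t1) \<and> m (x + 1) = 2 \<and>
     stored m item f (m (x + 2)) t0 \<and> stored m item f (m (x + 3)) t1"
| "stored m item f x (Node3 t0 t1 t2) \<longleftrightarrow> x + 4 < f \<and>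
     m x = height (Node3 t0 t1 t2) \<and> m (x + 1) = 3 \<and>
     stored m item f (m (x + 2)) t0 \<and> stored m item f (m (x + 3)) t1 \<and>
     stored m item f (m (x + 4)) t2"

text \<open>Calling convention. Input: register 0 is the address of an array with the root addresses of
  the subtrees of \<open>S\<close>, register 1 is the length of \<open>S\<close>, and all memory from the address in register
  2 on is free for use (with unknown contents). Other registers hold unknown values.
  Output: register 0 is the root address of a tree stored below the address in register 2.\<close>

definition slice_input :: "(nat \<Rightarrow> 'a) \<Rightarrow> 'a tree23 \<Rightarrow> pos list \<Rightarrow> state \<Rightarrow> bool" where
  "slice_input item T S s \<longleftrightarrow>
     regs s 1 = length S \<and> regs s 0 + length S \<le> regs s 2 \<and>
     (\<forall>i < length S. stored (mem s) item (regs s 2) (mem s (regs s 0 + i)) (subtree T (S ! i)))"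

definition tree_output :: "(nat \<Rightarrow> 'a) \<Rightarrow> 'a tree23 \<Rightarrow> state \<Rightarrow> bool" where
  "tree_output item T s \<longleftrightarrow> stored (mem s) item (regs s 2) (regs s 0) T"

end

theory Submission imports Defs
begin

text \<open>Let a slice be minimal. If it covers a suffix of the leaves of a subtree, then on every level it uses
  fewer trees than a node has children, since all children of a node could be replaced by the node itself.
  So the heights in a slice weakly increase and then weakly decrease, with at most two trees of each
  height on either side. The trees on each side are joined from the outside inwards, by grafting the lower tree
  onto the spine of the higher one at a cost of the height difference. The accumulated tree
  is never more than one level higher than the last tree, so the costs telescope to the maximal height plus the
  number of trees, and both are logarithmic in the number of leaves.\<close>

section \<open>Complete trees\<close>

text \<open>Joining a slice strictly from left to right can cost the square of the height, since
  every low tree that follows a high one costs a full height difference. The program is not told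
  where the heights turn from rising to falling, and it does not look for that place. A pass from
  the left stops at the first tree that is at least two levels below the accumulated one. It cannot
  stop before the end of the rising side, so what remains belongs to the falling side; a pass from
  the right consumes all of that, and one more join combines the two results. The tolerance of one
  level in the stopping test is forced: after one tree of height \<open>p\<close> the accumulated
  tree may have height \<open>p + 1\<close> while a second tree of height \<open>p\<close> is still
  to come. That the excess never reaches two levels depends on the shape of the root and not on
  heights alone, so the invariant must record whether the root is binary. The bounds refer to the
  slice only. With \<open>H\<close> the integer part of the binary logarithm of \<open>k\<close>,
  every tree has height at most \<open>H\<close>, and either side has at most
  \<open>2 * (H + 1)\<close> trees, however high \<open>T\<close> is.\<close>

fun full :: "nat \<Rightarrow> 'a tree23 \<Rightarrow> bool" where
  "full h (Leaf x) \<longleftrightarrow> h = 0"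
| "full h (Node2 l r) \<longleftrightarrow> (\<exists>g. h = Suc g \<and> full g l \<and> full g r)"
| "full h (Node3 l m r) \<longleftrightarrow> (\<exists>g. h = Suc g \<and> full g l \<and> full g m \<and> full g r)"

lemma full_height: "full h t \<Longrightarrow> height t = h"
  by (induction t arbitrary: h) fastforce+

lemma full_leaves: "full h t \<Longrightarrow> p \<in> set (leaves t) \<Longrightarrow> length p = h"
  by (induction t arbitrary: h p) fastforce+

lemma leaves_nonempty [simp]: "leaves t \<noteq> []"
  by (induction t) auto

lemma full_if_leaves: "\<forall>p \<in> set (leaves t). length p = d \<Longrightarrow> full d t"
proof (induction t arbitrary: d)
  case (Leaf x)
  then show ?case by simp
next
  case (Node2 l r)
  \<comment> \<open>The left child has a leaf, whose position in the whole node has length at least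
    1, so \<open>d\<close> is a successor.\<close>
  obtain g where g: "d = Suc g"
    using Node2.prems leaves_nonempty[of l] by (cases "leaves l") auto
  then have "\<forall>p \<in> set (leaves l). length p = g" "\<forall>p \<in> set (leaves r). length p = g"
    using Node2.prems by (simp_all add: ball_Un)
  then show ?case using Node2.IH g by simp
next
  case (Node3 l m r)
  obtain g where g: "d = Suc g"
    using Node3.prems leaves_nonempty[of l] by (cases "leaves l") auto
  then have "\<forall>p \<in> set (leaves l). length p = g" "\<forall>p \<in> set (leaves m). length p = g" "\<forall>p \<in> set (leaves r). length p = g"
    using Node3.prems by (simp_all add: ball_Un)
  then show ?case using Node3.IH g by simp
qed

text \<open>\<open>full\<close> carries the common depth as an index and recurses on the tree, which
  suits structural induction better than a condition on all leaf positions.\<close>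

lemma is_tree23_iff_full: "is_tree23 t \<longleftrightarrow> (\<exists>h. full h t)"
  unfolding is_tree23_def using full_leaves full_if_leaves by blast

section \<open>Joining two trees\<close>

text \<open>The flag \<open>d\<close> in the following definitions is the side of a tree at which something is added:
  left for \<open>True\<close>, right for \<open>False\<close>. Arguments come in the order from that side inwards.\<close>

definition mk2 :: "bool \<Rightarrow> 'a tree23 \<Rightarrow> 'a tree23 \<Rightarrow> 'a tree23" where
  "mk2 d a b = (if d then Node2 a b else Node2 b a)"

definition mk3 :: "bool \<Rightarrow> 'a tree23 \<Rightarrow> 'a tree23 \<Rightarrow> 'a tree23 \<Rightarrow> 'a tree23" where
  "mk3 d a b c = (if d then Node3 a b c else Node3 c b a)"

text \<open>What replaces the outermost child of a node after an insertion is one tree, \<open>(a, None)\<close>, or two trees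
  of the same height, \<open>(a, Some b)\<close>, with \<open>a\<close> on the outside.\<close>

fun absorb :: "bool \<Rightarrow> 'a tree23 \<Rightarrow> 'a tree23 \<times> 'a tree23 option \<Rightarrow> 'a tree23 \<times> 'a tree23 option" where
  "absorb d (Leaf x) R = R"
| "absorb d (Node2 l r) (a, None) = (mk2 d a (if d then r else l), None)"
| "absorb d (Node2 l r) (a, Some b) = (mk3 d a b (if d then r else l), None)"
| "absorb d (Node3 l m r) (a, None) = (mk3 d a m (if d then r else l), None)"
| "absorb d (Node3 l m r) (a, Some b) = (mk2 d a b, Some (mk2 d m (if d then r else l)))"

text \<open>Insertion is a \<open>foldr\<close> over this list, not a single recursion, so that it
  splits into the two machine loops: one pushes the list onto a stack on the way down, the other
  pops it on the way up. The node where the descent ends is kept apart in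
  \<open>spine_end\<close>.\<close>

fun spine :: "bool \<Rightarrow> nat \<Rightarrow> 'a tree23 \<Rightarrow> 'a tree23 list" where
  "spine d h (Leaf x) = []"
| "spine d h (Node2 l r) = (if h < height (Node2 l r)
     then Node2 l r # (if d then spine d h l else spine d h r) else [])"
| "spine d h (Node3 l m r) = (if h < height (Node3 l m r)
     then Node3 l m r # (if d then spine d h l else spine d h r) else [])"

fun spine_end :: "bool \<Rightarrow> nat \<Rightarrow> 'a tree23 \<Rightarrow> 'a tree23" where
  "spine_end d h (Leaf x) = Leaf x"
| "spine_end d h (Node2 l r) = (if h < height (Node2 l r)
     then (if d then spine_end d h l else spine_end d h r) else Node2 l r)"
| "spine_end d h (Node3 l m r) = (if h < height (Node3 l m r)
     then (if d then spine_end d h l else spine_end d h r) else Node3 l m r)"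

definition insert_spine :: "bool \<Rightarrow> 'a tree23 \<Rightarrow> 'a tree23 \<Rightarrow> 'a tree23 \<times> 'a tree23 option" where
  "insert_spine d x t = foldr (absorb d) (spine d (height x) t) (x, Some (spine_end d (height x) t))"

fun close :: "bool \<Rightarrow> 'a tree23 \<times> 'a tree23 option \<Rightarrow> 'a tree23" where
  "close d (a, None) = a"
| "close d (a, Some b) = mk2 d a b"

definition graft :: "bool \<Rightarrow> 'a tree23 \<Rightarrow> 'a tree23 \<Rightarrow> 'a tree23" where
  "graft d x t = close d (insert_spine d x t)"

definition join :: "'a tree23 \<Rightarrow> 'a tree23 \<Rightarrow> 'a tree23" where
  "join x y = (if height y < height x then graft False y x else graft True x y)"

definition join_dir :: "bool \<Rightarrow> 'a tree23 \<Rightarrow> 'a tree23 \<Rightarrow> 'a tree23" where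
  "join_dir d a t = (if d then join a t else join t a)"

fun full_res :: "nat \<Rightarrow> 'a tree23 \<times> 'a tree23 option \<Rightarrow> bool" where
  "full_res h (a, None) \<longleftrightarrow> full h a"
| "full_res h (a, Some b) \<longleftrightarrow> full h a \<and> full h b"

definition append_dir :: "bool \<Rightarrow> 'b list \<Rightarrow> 'b list \<Rightarrow> 'b list" where
  "append_dir d xs ys = (if d then xs @ ys else ys @ xs)"

fun res_items :: "bool \<Rightarrow> 'a tree23 \<times> 'a tree23 option \<Rightarrow> 'a list" where
  "res_items d (a, None) = items a"
| "res_items d (a, Some b) = append_dir d (items a) (items b)"

lemma full_mk [simp]:
  "full h (mk2 d a b) \<longleftrightarrow> (\<exists>g. h = Suc g \<and> full g a \<and> full g b)"
  "full h (mk3 d a b c) \<longleftrightarrow> (\<exists>g. h = Suc g \<and> full g a \<and> full g b \<and> full g c)"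
  by (auto simp: mk2_def mk3_def)

lemma full_absorb: "full (Suc h) n \<Longrightarrow> full_res h R \<Longrightarrow> full_res (Suc h) (absorb d n R)"
  by (induction d n R rule: absorb.induct) auto

text \<open>In a complete tree each step down lowers the height by exactly one. The length
  \<open>k - h\<close> is the measure of the running time of a join.\<close>

lemma full_spine:
  "full k t \<Longrightarrow> h \<le> k \<Longrightarrow> full h (spine_end d h t) \<and> length (spine d h t) = k - h \<and>
    (\<forall>i < k - h. full (k - i) (spine d h t ! i))"
proof (induction t arbitrary: k)
  case (Leaf x) then show ?case by auto
next
  case (Node2 l r)
  then obtain g where g: "k = Suc g" "full g l" "full g r" by auto
  then have ht: "height (Node2 l r) = Suc g" by (auto simp: full_height)
  show ?case
  proof (cases "h < Suc g")
    case True
    with g Node2.IH(1)[of g] Node2.IH(2)[of g] Node2.prems ht show ?thesis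
      by (cases d) (auto simp: nth_Cons Suc_diff_le Suc_diff_Suc simp del: height.simps split: nat.split)
  qed (use g ht Node2.prems in auto)
next
  case (Node3 l m r)
  then obtain g where g: "k = Suc g" "full g l" "full g m" "full g r" by auto
  then have ht: "height (Node3 l m r) = Suc g" by (auto simp: full_height)
  show ?case
  proof (cases "h < Suc g")
    case True
    with g Node3.IH(1)[of g] Node3.IH(3)[of g] Node3.prems ht show ?thesis
      by (cases d) (auto simp: nth_Cons Suc_diff_le Suc_diff_Suc simp del: height.simps split: nat.split)
  qed (use g ht Node3.prems in auto)
qed

text \<open>Unfolding the \<open>foldr\<close> once turns insertion into a node into
  \<open>absorb\<close> applied to insertion into its outermost child, so the claim follows level by
  level. At equal heights the spine is empty and the two given trees are themselves the two-tree
  result.\<close>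

lemma insert_spine_spec:
  "full h x \<Longrightarrow> full k t \<Longrightarrow> h \<le> k \<Longrightarrow>
    full_res k (insert_spine d x t) \<and> res_items d (insert_spine d x t) = append_dir d (items x) (items t)"
proof (induction t arbitrary: k)
  case (Leaf y) then show ?case by (auto simp: insert_spine_def)
next
  case (Node2 l r)
  then obtain g where g: "k = Suc g" "full g l" "full g r" by auto
  then have ht: "height (Node2 l r) = Suc g" "height x = h" using Node2.prems by (auto simp: full_height)
  let ?c = "if d then l else r"
  show ?case
  proof (cases "h < Suc g")
    case True
    have eq: "insert_spine d x (Node2 l r) = absorb d (Node2 l r) (insert_spine d x ?c)"
      using True ht by (simp add: insert_spine_def del: height.simps)
    have IH: "full_res g (insert_spine d x ?c) \<and> res_items d (insert_spine d x ?c) = append_dir d (items x) (items ?c)"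
      using Node2.IH(1)[of g] Node2.IH(2)[of g] g True Node2.prems(1) by auto
    obtain a b where ab: "insert_spine d x ?c = (a, b)" by force
    show ?thesis unfolding eq using IH full_absorb[of g "Node2 l r" "insert_spine d x ?c" d] g ab
      by (cases b) (auto simp: append_dir_def mk2_def mk3_def split: if_splits)
  qed (use g ht Node2.prems in \<open>auto simp: insert_spine_def simp del: height.simps\<close>)
next
  case (Node3 l m r)
  then obtain g where g: "k = Suc g" "full g l" "full g m" "full g r" by auto
  then have ht: "height (Node3 l m r) = Suc g" "height x = h" using Node3.prems by (auto simp: full_height)
  let ?c = "if d then l else r"
  show ?case
  proof (cases "h < Suc g")
    case True
    have eq: "insert_spine d x (Node3 l m r) = absorb d (Node3 l m r) (insert_spine d x ?c)"
      using True ht by (simp add: insert_spine_def del: height.simps)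
    have IH: "full_res g (insert_spine d x ?c) \<and> res_items d (insert_spine d x ?c) = append_dir d (items x) (items ?c)"
      using Node3.IH(1)[of g] Node3.IH(3)[of g] g True Node3.prems(1) by auto
    obtain a b where ab: "insert_spine d x ?c = (a, b)" by force
    show ?thesis unfolding eq using IH full_absorb[of g "Node3 l m r" "insert_spine d x ?c" d] g ab
      by (cases b) (auto simp: append_dir_def mk2_def mk3_def split: if_splits)
  qed (use g ht Node3.prems in \<open>auto simp: insert_spine_def simp del: height.simps\<close>)
qed

text \<open>A binary root has room for one more child. A tree that has just grown by a split has
  such a root, which keeps it from growing again when a second tree of the same height
  arrives.\<close>

fun is_node2 :: "'a tree23 \<Rightarrow> bool" where
  "is_node2 (Node2 l r) = True"
| "is_node2 _ = False"

text \<open>The height grows only if two trees are left at the top, and then \<open>close\<close>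
  puts a new binary root above them.\<close>

lemma graft_spec:
  assumes "full h x" "full k t" "h \<le> k"
  shows "items (graft d x t) = append_dir d (items x) (items t)"
    and "full k (graft d x t) \<or> full (Suc k) (graft d x t) \<and> is_node2 (graft d x t)"
proof -
  obtain a b where ab: "insert_spine d x t = (a, b)" by force
  show "items (graft d x t) = append_dir d (items x) (items t)"
    using insert_spine_spec[OF assms, of d] ab unfolding graft_def
    by (cases b) (auto simp: append_dir_def mk2_def)
  show "full k (graft d x t) \<or> full (Suc k) (graft d x t) \<and> is_node2 (graft d x t)"
    using insert_spine_spec[OF assms, of d] ab unfolding graft_def
    by (cases b) (auto simp: mk2_def)
qed

text \<open>The spine is the root alone, so \<open>x\<close> becomes a third child of it and nothing
  is split.\<close>

lemma full_graft_node2: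
  assumes "full h x" "full (Suc h) t" "is_node2 t"
  shows "full (Suc h) (graft d x t)"
proof -
  obtain l r where t: "t = Node2 l r" using assms(3) by (cases t) auto
  then have "height l = h" "height r = h" "height x = h" using assms by (auto simp: full_height)
  moreover from this have "spine d h l = []" "spine d h r = []" "spine_end d h l = l" "spine_end d h r = r"
    by (cases l; cases r; auto)+
  ultimately show ?thesis using assms t by (auto simp: graft_def insert_spine_def)
qed

text \<open>The last two conjuncts record when growth leaves a binary root behind and when a binary
  root prevents growth; the invariant of \<open>gather_staircase\<close> is maintained by
  them.\<close>

lemma join_dir_spec:
  assumes "full h a" "full k t"
  shows "items (join_dir d a t) = append_dir d (items a) (items t)"
    and "\<exists>g. full g (join_dir d a t) \<and> max h k \<le> g \<and> g \<le> Suc (max h k) \<and>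
      (h \<le> k \<longrightarrow> g = Suc k \<longrightarrow> is_node2 (join_dir d a t)) \<and>
      (h = Suc k \<longrightarrow> is_node2 a \<longrightarrow> g = h)"
proof -
  have hk: "height a = h" "height t = k" using assms by (auto simp: full_height)
  note g1 = graft_spec[OF assms(1,2)] and g2 = graft_spec[OF assms(2,1)]
  show "items (join_dir d a t) = append_dir d (items a) (items t)"
    using g1(1)[of True] g1(1)[of False] g2(1)[of True] g2(1)[of False]
    by (auto simp: join_dir_def join_def hk append_dir_def)
  consider "h = k" | "h < k" | "h = Suc k" "is_node2 a" | "h > k" "h = Suc k \<longrightarrow> \<not> is_node2 a" by linarith
  then show "\<exists>g. full g (join_dir d a t) \<and> max h k \<le> g \<and> g \<le> Suc (max h k) \<and>
      (h \<le> k \<longrightarrow> g = Suc k \<longrightarrow> is_node2 (join_dir d a t)) \<and>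
      (h = Suc k \<longrightarrow> is_node2 a \<longrightarrow> g = h)"
  proof cases
    case 1
    then show ?thesis using g1(2)[of True] g2(2)[of True]
      by (cases d) (auto simp: join_dir_def join_def hk)
  next
    case 2
    then show ?thesis using g1(2)[of "d"]
      by (cases d) (auto simp: join_dir_def join_def hk intro: exI[of _ k] exI[of _ "Suc k"])
  next
    case 3
    then show ?thesis using full_graft_node2[OF assms(2), of a "\<not> d"] assms(1)
      by (cases d) (auto simp: join_dir_def join_def hk intro: exI[of _ h])
  next
    case 4
    then show ?thesis using g2(2)[of "\<not> d"]
      by (cases d) (auto simp: join_dir_def join_def hk intro: exI[of _ h] exI[of _ "Suc h"])
  qed
qed

section \<open>Joining from one end\<close>

fun gather :: "bool \<Rightarrow> 'a tree23 \<Rightarrow> 'a tree23 list \<Rightarrow> 'a tree23 \<times> 'a tree23 list" where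
  "gather d a [] = (a, [])"
| "gather d a (t # ts) = (if Suc (height t) < height a then (a, t # ts) else gather d (join_dir d a t) ts)"

fun gather_cost :: "bool \<Rightarrow> 'a tree23 \<Rightarrow> 'a tree23 list \<Rightarrow> nat" where
  "gather_cost d a [] = 0"
| "gather_cost d a (t # ts) = (if Suc (height t) < height a then 1
     else Suc (max (height a) (height t) - min (height a) (height t)) + gather_cost d (join_dir d a t) ts)"

definition items_dir :: "bool \<Rightarrow> 'a tree23 list \<Rightarrow> 'a list" where
  "items_dir d ts = concat (map items (if d then ts else rev ts))"

lemma items_dir_simps [simp]: "items_dir d [] = []" "items_dir d (t # ts) = append_dir d (items t) (items_dir d ts)"
  by (auto simp: items_dir_def append_dir_def)

text \<open>By the stopping test, a tree that is joined lies at most one level below the accumulated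
  tree, so the height difference is at most the growth of that tree plus 1. The growths telescope to
  \<open>h' - h\<close>; each tree is charged 2, one for the test and one for the extra level, and
  the final 1 pays for the test that stops the pass. The same test bounds the result: before any
  join the height is at most \<open>H + 1\<close>.\<close>

lemma gather_spec:
  assumes "full h a" "\<forall>t \<in> set ts. \<exists>k\<le>H. full k t" "h \<le> Suc (Suc H)" "gather d a ts = (a', rest)"
  shows "\<exists>n h'. rest = drop n ts \<and> full h' a' \<and> h \<le> h' \<and> h' \<le> Suc (Suc H) \<and>
    items a' = append_dir d (items a) (items_dir d (take n ts)) \<and>
    gather_cost d a ts \<le> (h' - h) + 2 * length ts + 1"
  using assms
proof (induction ts arbitrary: a h)
  case Nil
  then show ?case by (auto simp: append_dir_def)
next
  case (Cons t ts)
  then obtain k where k: "full k t" "k \<le> H" by auto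
  have heights: "height a = h" "height t = k" using Cons.prems k by (auto simp: full_height)
  show ?case
  proof (cases "Suc k < h")
    case True
    then show ?thesis using Cons.prems heights by (intro exI[of _ 0] exI[of _ h]) (auto simp: append_dir_def)
  next
    case False
    from join_dir_spec[OF Cons.prems(1) k(1), of d] obtain g where
      g: "full g (join_dir d a t)" "max h k \<le> g" "g \<le> Suc (max h k)"
        "items (join_dir d a t) = append_dir d (items a) (items t)"
      by auto
    have "g \<le> Suc (Suc H)" using g k False by auto
    with Cons.IH[of g "join_dir d a t"] Cons.prems g heights False obtain n h' where
      n: "rest = drop n ts" "full h' a'" "g \<le> h'" "h' \<le> Suc (Suc H)"
       "items a' = append_dir d (items (join_dir d a t)) (items_dir d (take n ts))"
       "gather_cost d (join_dir d a t) ts \<le> (h' - g) + 2 * length ts + 1"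
      by auto
    have "max h k - min h k \<le> (g - h) + 1" using g(2) False by auto
    then have "gather_cost d a (t # ts) \<le> (h' - h) + 2 * length (t # ts) + 1"
      using n g(2) heights False by auto
    then show ?thesis using n g by (intro exI[of _ "Suc n"] exI[of _ h']) (auto simp: append_dir_def)
  qed
qed


text \<open>Strictness between entries two places apart says that no height occurs three
  times.\<close>

fun staircase :: "nat list \<Rightarrow> bool" where
  "staircase (x # y # z # zs) \<longleftrightarrow> x \<le> y \<and> x < z \<and> staircase (y # z # zs)"
| "staircase [x, y] \<longleftrightarrow> x \<le> y"
| "staircase xs \<longleftrightarrow> True"

text \<open>The accumulated tree never gets more than one level above the last tree \<open>p\<close>, and if it is
  one level above after a single tree of that height, then its root was made by a split and still has
  room for a second one. Hence the loop does not stop within a staircase.\<close>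

lemma gather_staircase:
  assumes "full h a" "h \<le> Suc p" "staircase (p # map height ts)" "\<forall>t \<in> set ts. \<exists>k. full k t"
    and "h = Suc p \<Longrightarrow> \<not> is_node2 a \<Longrightarrow> ts \<noteq> [] \<Longrightarrow> p < height (hd ts)"
  shows "length (snd (gather d a (ts @ us))) \<le> length us"
  using assms
proof (induction ts arbitrary: a h p)
  case Nil
  have "length (snd (gather d a us)) \<le> length us" by (induction us arbitrary: a) (auto intro: le_SucI)
  then show ?case by simp
next
  case (Cons t ts)
  obtain k where k: "full k t" using Cons.prems by auto
  then have ht: "height t = k" "height a = h" using full_height Cons.prems(1) by auto
  have pk: "p \<le> k" "staircase (k # map height ts)" "ts \<noteq> [] \<Longrightarrow> p < height (hd ts)"
    using Cons.prems(3) ht by (cases ts; auto)+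
  obtain g where g: "full g (join_dir d a t)" "g \<le> Suc (max h k)"
      "h \<le> k \<longrightarrow> g = Suc k \<longrightarrow> is_node2 (join_dir d a t)" "h = Suc k \<longrightarrow> is_node2 a \<longrightarrow> g = h"
    using join_dir_spec(2)[OF Cons.prems(1) k, of d] by auto
  \<comment> \<open>If the accumulated tree is higher than \<open>t\<close>, then \<open>t\<close>
    is the second tree of its height. The last premise then makes the root binary, so
    \<open>t\<close> is taken in without growth, and the tree after \<open>t\<close> is strictly
    higher.\<close>
  have hk: "h = Suc k \<Longrightarrow> p = k" using Cons.prems(2) pk by simp
  have "g \<le> Suc k" using g Cons.prems(2,5) pk hk ht by (cases "h \<le> k") auto
  moreover have "p < height (hd ts)" if "ts \<noteq> []" using pk(3) that .
  moreover have "k < height (hd ts)" if "g = Suc k" "\<not> is_node2 (join_dir d a t)" "ts \<noteq> []"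
    using that g hk pk Cons.prems(2) by (cases "h \<le> k") auto
  ultimately have "length (snd (gather d (join_dir d a t) (ts @ us))) \<le> length us"
    using Cons.IH[OF g(1), of k] pk Cons.prems by auto
  then show ?case using ht Cons.prems pk by auto
qed

section \<open>Running programs\<close>

text \<open>The number of steps is an upper bound, so that branches of different lengths share one
  bound and constants can be rounded up.\<close>

definition run :: "com \<Rightarrow> nat \<Rightarrow> state \<Rightarrow> state \<Rightarrow> bool" where
  "run c T s s' \<longleftrightarrow> (\<exists>t\<le>T. exec c s t s')"

lemma run_mono: "run c T s s' \<Longrightarrow> T \<le> U \<Longrightarrow> run c U s s'"
  unfolding run_def using le_trans by blast

lemma run_seq: "run c1 T1 s s1 \<Longrightarrow> run c2 T2 s1 s2 \<Longrightarrow> run (Seq c1 c2) (T1 + T2) s s2"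
  unfolding run_def using exec.Seq add_mono by blast

lemma run_if:
  "run (if regs s a < regs s b then c1 else c2) T s s' \<Longrightarrow> run (IfLess a b c1 c2) (Suc T) s s'"
  unfolding run_def using exec.IfTrue exec.IfFalse by (cases "regs s a < regs s b") fastforce+

lemma run_while_false: "\<not> regs s a < regs s b \<Longrightarrow> run (WhileLess a b c) 1 s s"
  unfolding run_def using exec.WhileFalse by blast

lemma run_while_true:
  assumes "regs s a < regs s b" "run c T1 s s1" "run (WhileLess a b c) T2 s1 s2"
  shows "run (WhileLess a b c) (Suc (T1 + T2)) s s2"
proof -
  obtain t1 t2 where t: "t1 \<le> T1" "exec c s t1 s1" "t2 \<le> T2" "exec (WhileLess a b c) s1 t2 s2"
    using assms unfolding run_def by blast
  then have "exec (WhileLess a b c) s (1 + t1 + t2) s2" using exec.WhileTrue assms by blast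
  moreover have "1 + t1 + t2 \<le> Suc (T1 + T2)" using t by simp
  ultimately show ?thesis unfolding run_def by blast
qed

fun loop_free :: "com \<Rightarrow> bool" where
  "loop_free (Seq c1 c2) \<longleftrightarrow> loop_free c1 \<and> loop_free c2"
| "loop_free (IfLess a b c1 c2) \<longleftrightarrow> loop_free c1 \<and> loop_free c2"
| "loop_free (WhileLess a b c) \<longleftrightarrow> False"
| "loop_free _ \<longleftrightarrow> True"

fun max_time :: "com \<Rightarrow> nat" where
  "max_time (Seq c1 c2) = max_time c1 + max_time c2"
| "max_time (IfLess a b c1 c2) = Suc (max (max_time c1) (max_time c2))"
| "max_time _ = 1"

text \<open>The last equation is right for \<open>Skip\<close>; for \<open>WhileLess\<close> it is a
  placeholder, and \<open>loop_free\<close> excludes that case.\<close>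

fun effect :: "com \<Rightarrow> state \<Rightarrow> state" where
  "effect (SetConst a n) s = set_reg a n s"
| "effect (Copy a b) s = set_reg a (regs s b) s"
| "effect (Add a b c) s = set_reg a (regs s b + regs s c) s"
| "effect (Sub a b c) s = set_reg a (regs s b - regs s c) s"
| "effect (Load a b) s = set_reg a (mem s (regs s b)) s"
| "effect (Store a b) s = set_mem (regs s a) (regs s b) s"
| "effect (Seq c1 c2) s = effect c2 (effect c1 s)"
| "effect (IfLess a b c1 c2) s = (if regs s a < regs s b then effect c1 s else effect c2 s)"
| "effect _ s = s"

text \<open>Straight-line code can thus be run by the simplifier, through \<open>effect\<close> and
  \<open>max_time\<close>; only the loops need an induction.\<close>

lemma run_effect: "loop_free c \<Longrightarrow> max_time c \<le> T \<Longrightarrow> run c T s (effect c s)"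
proof (induction c arbitrary: s T)
  case (Seq c1 c2)
  then have "run (Seq c1 c2) (max_time c1 + max_time c2) s (effect c2 (effect c1 s))"
    by (intro run_seq[of _ _ _ "effect c1 s"]) auto
  then show ?case using Seq.prems run_mono by fastforce
next
  case (IfLess a b c1 c2)
  then have "run (IfLess a b c1 c2) (Suc (max (max_time c1) (max_time c2))) s (effect (IfLess a b c1 c2) s)"
    by (intro run_if) auto
  then show ?case using IfLess.prems run_mono by fastforce
qed (auto simp: run_def intro!: exI[of _ "Suc 0"] intro: exec.intros[unfolded One_nat_def])

lemma regs_mem_set [simp]:
  "regs (set_reg a v s) = (regs s)(a := v)" "mem (set_reg a v s) = mem s"
  "regs (set_mem x v s) = regs s" "mem (set_mem x v s) = (mem s)(x := v)"
  by (auto simp: set_reg_def set_mem_def)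

abbreviation seq (infixr ";;" 60) where "c1 ;; c2 \<equiv> Seq c1 c2"

section \<open>The join program\<close>

text \<open>Register 2 is the first free address. Registers 20 to 23 hold the constants 1, 2, 3 and 0.
  The unread section of the array is between the addresses in registers 24 (inclusive) and 25 (exclusive),
  register 26 is the accumulated tree, register 28 the tree read last, and 29 the result of the first pass.
  Registers below 20 are scratch. All writes go to fresh memory, hence every tree stored before stays
  valid, however records are shared.\<close>

definition has_tree :: "state \<Rightarrow> (nat \<Rightarrow> 'a) \<Rightarrow> nat \<Rightarrow> 'a tree23 \<Rightarrow> bool" where
  "has_tree s item x t \<longleftrightarrow> stored (mem s) item (regs s 2) x t"

definition extends :: "state \<Rightarrow> state \<Rightarrow> bool" where
  "extends s s' \<longleftrightarrow> regs s 2 \<le> regs s' 2 \<and> (\<forall>x < regs s 2. mem s' x = mem s x)"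

lemma extends_refl [simp]: "extends s s"
  by (simp add: extends_def)

lemma extends_trans: "extends s s' \<Longrightarrow> extends s' s'' \<Longrightarrow> extends s s''"
  by (auto simp: extends_def)

text \<open>Every cell that \<open>stored\<close> reads lies below \<open>f\<close>, so agreement
  below \<open>f\<close> suffices. No separation between trees is required, which permits shared
  records.\<close>

lemma stored_mono:
  "stored m item f x t \<Longrightarrow> \<forall>y<f. m' y = m y \<Longrightarrow> f \<le> f' \<Longrightarrow> stored m' item f' x t"
proof (induction t arbitrary: x)
  case (Leaf a) then show ?case by auto
next
  case (Node2 l r)
  then have "m' x = m x" "m' (x+1) = m (x+1)" "m' (x+2) = m (x+2)" "m' (x+3) = m (x+3)" by auto
  then show ?case using Node2 by auto
next
  case (Node3 l c r)
  then have "m' x = m x" "m' (x+1) = m (x+1)" "m' (x+2) = m (x+2)" "m' (x+3) = m (x+3)"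
    "m' (x+4) = m (x+4)" by auto
  then show ?case using Node3 by auto
qed

lemma has_tree_extends: "extends s s' \<Longrightarrow> has_tree s item x t \<Longrightarrow> has_tree s' item x t"
  unfolding has_tree_def extends_def using stored_mono by blast

lemma has_tree_height: "has_tree s item x t \<Longrightarrow> mem s x = height t"
  unfolding has_tree_def by (cases t) auto

definition constants :: "state \<Rightarrow> bool" where
  "constants s \<longleftrightarrow> regs s 20 = 1 \<and> regs s 21 = 2 \<and> regs s 22 = 3 \<and> regs s 23 = 0"

text \<open>The height of a new node is computed from its first child only, which is correct as all
  children have the same height.\<close>

definition alloc2 :: "bool \<Rightarrow> reg \<Rightarrow> reg \<Rightarrow> reg \<Rightarrow> com" where
  "alloc2 d dst a b = (Load 7 a ;; Add 7 7 20 ;; Store 2 7 ;; Add 6 2 20 ;; Store 6 21 ;;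
     Add 6 6 20 ;; Store 6 (if d then a else b) ;; Add 6 6 20 ;; Store 6 (if d then b else a) ;;
     Add 6 6 20 ;; Copy dst 2 ;; Copy 2 6)"

definition alloc3 :: "bool \<Rightarrow> reg \<Rightarrow> reg \<Rightarrow> reg \<Rightarrow> reg \<Rightarrow> com" where
  "alloc3 d dst a b c = (Load 7 a ;; Add 7 7 20 ;; Store 2 7 ;; Add 6 2 20 ;; Store 6 22 ;;
     Add 6 6 20 ;; Store 6 (if d then a else c) ;; Add 6 6 20 ;; Store 6 b ;; Add 6 6 20 ;;
     Store 6 (if d then c else a) ;; Add 6 6 20 ;; Copy dst 2 ;; Copy 2 6)"

lemma loop_free_alloc [simp]:
  "loop_free (alloc2 d x a b)" "loop_free (alloc3 d x a b c)"
  "max_time (alloc2 d x a b) = 12" "max_time (alloc3 d x a b c) = 14"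
  by (auto simp: alloc2_def alloc3_def)

text \<open>The target \<open>x\<close> may coincide with a source: it is written only after both
  children have been stored. The sources must avoid registers 2, 6 and 7, since 6 and 7 are
  overwritten before the last source is read and 2 is the allocation pointer.\<close>

lemma alloc2:
  fixes d :: bool
  assumes "constants s" "full h t" "full h u" "has_tree s item (regs s a) t" "has_tree s item (regs s b) u"
    and "a \<notin> {2, 6, 7}" "b \<notin> {2, 6, 7}" "x \<notin> {2, 6, 7}"
  defines "s' \<equiv> effect (alloc2 d x a b) s"
  shows "has_tree s' item (regs s' x) (mk2 d t u)" "extends s s'" "\<forall>r. r \<notin> {x, 2, 6, 7} \<longrightarrow> regs s' r = regs s r"
proof -
  let ?f = "regs s 2"
  have r2: "regs s' 2 = ?f + 4" "regs s' x = ?f"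
    using assms(1,6-8) unfolding s'_def alloc2_def constants_def by auto
  have m: "mem s' ?f = Suc h" "mem s' (?f + 1) = 2"
    "mem s' (?f + 2) = regs s (if d then a else b)" "mem s' (?f + 3) = regs s (if d then b else a)"
    "\<forall>y<?f. mem s' y = mem s y"
    using assms(1,6-8) has_tree_height[OF assms(4)] full_height[OF assms(2)]
    unfolding s'_def alloc2_def constants_def by auto
  show e: "extends s s'" using r2 m unfolding extends_def by auto
  show "\<forall>r. r \<notin> {x, 2, 6, 7} \<longrightarrow> regs s' r = regs s r"
    unfolding s'_def alloc2_def by auto
  show "has_tree s' item (regs s' x) (mk2 d t u)"
    using has_tree_extends[OF e assms(4)] has_tree_extends[OF e assms(5)] m r2 assms(2,3) unfolding has_tree_def
    by (cases d) (auto simp: mk2_def full_height)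
qed

lemma alloc3:
  fixes d :: bool
  assumes "constants s" "full h t" "full h u" "full h v" "has_tree s item (regs s a) t" "has_tree s item (regs s b) u"
    "has_tree s item (regs s c) v"
    and "a \<notin> {2, 6, 7}" "b \<notin> {2, 6, 7}" "c \<notin> {2, 6, 7}" "x \<notin> {2, 6, 7}"
  defines "s' \<equiv> effect (alloc3 d x a b c) s"
  shows "has_tree s' item (regs s' x) (mk3 d t u v)" "extends s s'" "\<forall>r. r \<notin> {x, 2, 6, 7} \<longrightarrow> regs s' r = regs s r"
proof -
  let ?f = "regs s 2"
  have r2: "regs s' 2 = ?f + 5" "regs s' x = ?f"
    using assms(1,8-11) unfolding s'_def alloc3_def constants_def by auto
  have m: "mem s' ?f = Suc h" "mem s' (?f + 1) = 3"
    "mem s' (?f + 2) = regs s (if d then a else c)" "mem s' (?f + 3) = regs s b"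
    "mem s' (?f + 4) = regs s (if d then c else a)"
    "\<forall>y<?f. mem s' y = mem s y"
    using assms(1,8-11) has_tree_height[OF assms(5)] full_height[OF assms(2)]
    unfolding s'_def alloc3_def constants_def by auto
  show e: "extends s s'" using r2 m unfolding extends_def by auto
  show "\<forall>r. r \<notin> {x, 2, 6, 7} \<longrightarrow> regs s' r = regs s r"
    unfolding s'_def alloc3_def by auto
  show "has_tree s' item (regs s' x) (mk3 d t u v)"
    using has_tree_extends[OF e assms(5)] has_tree_extends[OF e assms(6)] has_tree_extends[OF e assms(7)] m r2 assms(2-4) unfolding has_tree_def
    by (cases d) (auto simp: mk3_def full_height)
qed

section \<open>Climbing the spine: rebuilding one node after another\<close>

fun has_result :: "state \<Rightarrow> (nat \<Rightarrow> 'a) \<Rightarrow> 'a tree23 \<times> 'a tree23 option \<Rightarrow> bool" where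
  "has_result s item (t, None) \<longleftrightarrow> regs s 10 = 0 \<and> has_tree s item (regs s 8) t"
| "has_result s item (t, Some u) \<longleftrightarrow> regs s 10 = 1 \<and> has_tree s item (regs s 8) t \<and> has_tree s item (regs s 9) u"

text \<open>Fetches the children other than the one being replaced: register 15 receives its
  neighbour, register 16 the one beyond. At a binary node register 16 receives a meaningless value,
  which \<open>rebuild\<close> does not read in that case. From the right, the addresses depend on
  the number of children in register 14, as children are stored from left to right.\<close>

definition read_node :: "bool \<Rightarrow> com" where
  "read_node d = (Sub 11 11 20 ;; Load 13 11 ;; Add 6 13 20 ;; Load 14 6 ;;
     (if d then Add 6 6 20 ;; Add 6 6 20 ;; Load 15 6 ;; Add 6 6 20 ;; Load 16 6
      else Add 6 13 14 ;; Load 15 6 ;; Sub 6 6 20 ;; Load 16 6))"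

definition rebuild :: "bool \<Rightarrow> com" where
  "rebuild d =
     IfLess 10 20
       (IfLess 14 22 (alloc2 d 8 8 15) (alloc3 d 8 8 15 16))
       (IfLess 14 22 (alloc3 d 8 8 9 15 ;; Copy 10 23) (alloc2 d 8 8 9 ;; alloc2 d 9 15 16))"

fun far :: "bool \<Rightarrow> 'a tree23 \<Rightarrow> 'a tree23" where
  "far d (Node2 l r) = (if d then r else l)"
| "far d (Node3 l m r) = (if d then r else l)"
| "far d t = t"

lemma read_node:
  fixes d :: bool
  assumes "constants s" "has_tree s item (mem s (regs s 11 - 1)) n"
  defines "s' \<equiv> effect (read_node d) s"
  shows "regs s' 11 = regs s 11 - 1" "\<forall>r. r \<notin> {6,11,13,14,15,16} \<longrightarrow> regs s' r = regs s r" "mem s' = mem s"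
    "n = Node2 l r \<Longrightarrow> regs s' 14 = 2 \<and> has_tree s item (regs s' 15) (far d n)"
    "n = Node3 l m r \<Longrightarrow> regs s' 14 = 3 \<and> has_tree s item (regs s' 15) m \<and> has_tree s item (regs s' 16) (far d n)"
  using assms(1,2) unfolding s'_def read_node_def constants_def has_tree_def
  by (auto simp: numeral_eq_Suc)


lemma constants_cong: "\<forall>r\<ge>20. regs s' r = regs s r \<Longrightarrow> constants s \<Longrightarrow> constants s'"
  by (auto simp: constants_def)

lemma rebuild:
  fixes d :: bool
  assumes "constants s" "full (Suc h) n" "full_res h R" "has_result s item R"
    "\<And>l r. n = Node2 l r \<Longrightarrow> regs s 14 = 2 \<and> has_tree s item (regs s 15) (far d n)"
    "\<And>l m r. n = Node3 l m r \<Longrightarrow> regs s 14 = 3 \<and> has_tree s item (regs s 15) m \<and> has_tree s item (regs s 16) (far d n)"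
  defines "s' \<equiv> effect (rebuild d) s"
  shows "has_result s' item (absorb d n R) \<and> extends s s' \<and> (\<forall>r. r \<notin> {2,6,7,8,9,10} \<longrightarrow> regs s' r = regs s r)"
proof -
  obtain a b where R: "R = (a, b)" by force
  have cs: "regs s 20 = 1" "regs s 22 = 3" "regs s 23 = 0" using assms(1) by (auto simp: constants_def)
  consider (L) l r where "n = Node2 l r" "b = None" | (M) l r u where "n = Node2 l r" "b = Some u"
    | (N) l m r where "n = Node3 l m r" "b = None" | (P) l m r u where "n = Node3 l m r" "b = Some u"
    using assms(2) by (cases n; cases b) auto
  then show ?thesis
  proof cases
    case L
    have s': "s' = effect (alloc2 d 8 8 15) s"
      unfolding s'_def rebuild_def using L R assms(4) assms(5) cs by auto
    have f: "full h a" "full h (far d n)" "has_tree s item (regs s 8) a" "has_tree s item (regs s 15) (far d n)"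
      "regs s 10 = 0"
      using L R assms(2-5) by auto
    from alloc2[OF assms(1) f(1-4), of 8 d] show ?thesis using f(5) L R unfolding s' by auto
  next
    case M
    have s': "s' = set_reg 10 0 (effect (alloc3 d 8 8 9 15) s)"
      unfolding s'_def rebuild_def using M R assms(4) assms(5) cs by (auto simp: alloc3_def)
    have f: "full h a" "full h u" "full h (far d n)" "has_tree s item (regs s 8) a" "has_tree s item (regs s 9) u"
      "has_tree s item (regs s 15) (far d n)"
      using M R assms(2-5) by auto
    from alloc3[OF assms(1) f(1-6), of 8 d] show ?thesis using M R unfolding s'
      by (auto simp: has_tree_def extends_def)
  next
    case N
    have s': "s' = effect (alloc3 d 8 8 15 16) s"
      unfolding s'_def rebuild_def using N R assms(4) assms(6) cs by auto
    have f: "full h a" "full h m" "full h (far d n)" "has_tree s item (regs s 8) a" "has_tree s item (regs s 15) m"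
      "has_tree s item (regs s 16) (far d n)" "regs s 10 = 0"
      using N R assms(2-4) assms(6) by auto
    from alloc3[OF assms(1) f(1-6), of 8 d] show ?thesis using f(7) N R unfolding s' by auto
  next
    case P
    \<comment> \<open>Four trees become two binary nodes, and the flag in register 10 stays 1. The
      first allocation leaves registers 15 and 16 alone, so the second can still read the two
      remaining children.\<close>
    define s1 where "s1 = effect (alloc2 d 8 8 9) s"
    have s': "s' = effect (alloc2 d 9 15 16) s1"
      unfolding s'_def rebuild_def s1_def using P R assms(4) assms(6) cs by auto
    have f: "full h a" "full h u" "has_tree s item (regs s 8) a" "has_tree s item (regs s 9) u"
      "full h m" "full h (far d n)" "has_tree s item (regs s 15) m"
      "has_tree s item (regs s 16) (far d n)" "regs s 10 = 1"
      using P R assms(2-4) assms(6) by auto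
    have g: "has_tree s1 item (regs s1 8) (mk2 d a u)" "extends s s1" "\<forall>r. r \<notin> {8, 2, 6, 7} \<longrightarrow> regs s1 r = regs s r"
      using alloc2[OF assms(1) f(1-4), of 8 d] unfolding s1_def by auto
    have c1: "constants s1" using g(3) assms(1) by (auto simp: constants_def)
    have "has_tree s1 item (regs s1 15) m" "has_tree s1 item (regs s1 16) (far d n)"
      using has_tree_extends[OF g(2) f(7)] has_tree_extends[OF g(2) f(8)] g(3) by auto
    from alloc2[OF c1 f(5,6) this, of 9 d] have h: "has_tree s' item (regs s' 9) (mk2 d m (far d n))" "extends s1 s'"
      "\<forall>r. r \<notin> {9, 2, 6, 7} \<longrightarrow> regs s' r = regs s1 r" unfolding s' by auto
    show ?thesis using has_tree_extends[OF h(2) g(1)] extends_trans[OF g(2) h(2)] h g f(9) P R by auto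
  qed
qed

definition up_step :: "bool \<Rightarrow> com" where
  "up_step d = (read_node d ;; rebuild d)"

lemma up_step:
  fixes d :: bool
  assumes "constants s" "full (Suc h) n" "full_res h R" "has_result s item R" "has_tree s item (mem s (regs s 11 - 1)) n"
  shows "\<exists>s'. run (up_step d) 40 s s' \<and> has_result s' item (absorb d n R) \<and> extends s s' \<and>
    regs s' 11 = regs s 11 - 1 \<and> (\<forall>r. r = 12 \<or> r \<ge> 20 \<longrightarrow> regs s' r = regs s r)"
proof -
  define s1 where "s1 = effect (read_node d) s"
  note r = read_node[OF assms(1,5), where d = d, folded s1_def]
  have c: "constants s1" using r(2) assms(1) by (auto simp: constants_def)
  have st1: "has_tree s1 item x t \<longleftrightarrow> has_tree s item x t" for x t
    using r(2,3) by (auto simp: has_tree_def)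
  have "has_result s1 item R" using assms(4) r(2) st1
    by (cases "(s, item, R)" rule: has_result.cases) auto
  note R = rebuild[OF c assms(2,3) this, of d]
  define s' where "s' = effect (rebuild d) s1"
  have e: "extends s s1" using r(2,3) by (auto simp: extends_def)
  have A: "has_result s' item (absorb d n R) \<and> extends s1 s' \<and> (\<forall>r. r \<notin> {2,6,7,8,9,10} \<longrightarrow> regs s' r = regs s1 r)"
    unfolding s'_def by (rule R) (use r(4,5) st1 in auto)
  have "run (up_step d) 40 s (effect (up_step d) s)"
    by (rule run_effect) (auto simp: up_step_def read_node_def rebuild_def)
  moreover have "effect (up_step d) s = s'" by (simp add: up_step_def s'_def s1_def)
  ultimately show ?thesis using A extends_trans[OF e] r(1,2) by (intro exI[of _ s']) auto
qed

text \<open>Describes both the input array and the stack of spine nodes. The bound by register 2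
  puts the cells of the array itself below the free address, so \<open>extends\<close> preserves
  them together with the trees.\<close>

definition has_trees :: "state \<Rightarrow> (nat \<Rightarrow> 'a) \<Rightarrow> nat \<Rightarrow> 'a tree23 list \<Rightarrow> bool" where
  "has_trees s item p ts \<longleftrightarrow> p + length ts \<le> regs s 2 \<and> (\<forall>i < length ts. has_tree s item (mem s (p + i)) (ts ! i))"

lemma has_trees_extends: "extends s s' \<Longrightarrow> has_trees s item p ts \<Longrightarrow> has_trees s' item p ts"
  unfolding has_trees_def using has_tree_extends[of s s' item] by (fastforce simp: extends_def)

text \<open>The induction goes from the end of the list because the top of the stack is the lowest
  spine node, and this is also where \<open>foldr\<close> begins.\<close>

lemma up_loop:
  fixes d :: bool
  assumes "constants s" "\<forall>i < length ns. full (h + length ns - i) (ns ! i)" "full_res h R" "has_result s item R"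
    "has_trees s item (regs s 12) ns" "regs s 11 = regs s 12 + length ns"
  shows "\<exists>s'. run (WhileLess 12 11 (up_step d)) (41 * length ns + 1) s s' \<and>
    has_result s' item (foldr (absorb d) ns R) \<and> full_res (h + length ns) (foldr (absorb d) ns R) \<and>
    extends s s' \<and> (\<forall>r\<ge>20. regs s' r = regs s r)"
  using assms
proof (induction ns arbitrary: s h R rule: rev_induct)
  case Nil
  then show ?case using run_while_false[of s 12 11] by (intro exI[of _ s]) auto
next
  case (snoc n ns)
  have n: "full (Suc h) n" using snoc.prems(2)[rule_format, of "length ns"] by auto
  have "has_tree s item (mem s (regs s 11 - 1)) n"
    using snoc.prems(5,6) by (auto simp: has_trees_def dest!: spec[of _ "length ns"])
  from up_step[OF snoc.prems(1) n snoc.prems(3,4) this, of d] obtain s1 where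
    s1: "run (up_step d) 40 s s1" "has_result s1 item (absorb d n R)" "extends s s1"
      "regs s1 11 = regs s 11 - 1" "\<forall>r. r = 12 \<or> r \<ge> 20 \<longrightarrow> regs s1 r = regs s r" by auto
  have c: "constants s1" using constants_cong s1(5) snoc.prems(1) by blast
  have "\<forall>i < length ns. full (Suc h + length ns - i) (ns ! i)"
    using snoc.prems(2) by (auto simp: nth_append split: if_splits dest: less_SucI)
  moreover have "has_trees s1 item (regs s1 12) ns"
    using has_trees_extends[OF s1(3) snoc.prems(5)] s1(5) by (auto simp: has_trees_def nth_append split: if_splits)
  moreover have "regs s1 11 = regs s1 12 + length ns" using s1(4,5) snoc.prems(6) by auto
  ultimately obtain s' where s': "run (WhileLess 12 11 (up_step d)) (41 * length ns + 1) s1 s'"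
    "has_result s' item (foldr (absorb d) ns (absorb d n R))"
    "full_res (Suc h + length ns) (foldr (absorb d) ns (absorb d n R))"
    "extends s1 s'" "\<forall>r\<ge>20. regs s' r = regs s1 r"
    using snoc.IH[OF c _ full_absorb[OF n snoc.prems(3)] s1(2)] by blast
  have "run (WhileLess 12 11 (up_step d)) (Suc (40 + (41 * length ns + 1))) s s'"
    using run_while_true[OF _ s1(1) s'(1)] snoc.prems(6) by simp
  then show ?case using s' extends_trans[OF s1(3) s'(4)] s1(5) by (intro exI[of _ s']) auto
qed

section \<open>Descending the spine and the complete join\<close>

definition down_step :: "bool \<Rightarrow> com" where
  "down_step d = (Store 2 18 ;; Add 2 2 20 ;;
     (if d then Add 6 18 21 else Add 6 18 20 ;; Load 7 6 ;; Add 6 6 7) ;; Load 18 6 ;; Load 19 18)"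

fun near :: "bool \<Rightarrow> 'a tree23 \<Rightarrow> 'a tree23" where
  "near d (Node2 l r) = (if d then l else r)"
| "near d (Node3 l m r) = (if d then l else r)"
| "near d t = t"

text \<open>From the right, the outermost child is found at an offset of 1 plus the number of
  children, so one computation serves binary and ternary nodes.\<close>

lemma down_step:
  fixes d :: bool
  assumes "constants s" "has_tree s item (regs s 18) t" "0 < height t"
  defines "s' \<equiv> effect (down_step d) s"
  shows "has_tree s' item (regs s' 18) (near d t)" "regs s' 19 = height (near d t)" "regs s' 2 = Suc (regs s 2)"
    "mem s' (regs s 2) = regs s 18" "extends s s'" "\<forall>r. r \<notin> {2,6,7,18,19} \<longrightarrow> regs s' r = regs s r"
proof -
  show e: "extends s s'" and "regs s' 2 = Suc (regs s 2)" "mem s' (regs s 2) = regs s 18"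
    and "\<forall>r. r \<notin> {2,6,7,18,19} \<longrightarrow> regs s' r = regs s r"
    using assms(1) unfolding s'_def extends_def down_step_def constants_def by auto
  have "has_tree s item (regs s' 18) (near d t) \<and> regs s' 19 = mem s' (regs s' 18)"
  proof (cases t)
    case (Node2 l r)
    then show ?thesis using assms(1,2) unfolding s'_def down_step_def constants_def has_tree_def
      by (auto simp: numeral_eq_Suc)
  next
    case (Node3 l m r)
    then show ?thesis using assms(1,2) unfolding s'_def down_step_def constants_def has_tree_def
      by (auto simp: numeral_eq_Suc)
  qed (use assms(3) in auto)
  then show "has_tree s' item (regs s' 18) (near d t)" "regs s' 19 = height (near d t)"
    using has_tree_extends[OF e] has_tree_height by metis+
qed

lemma spine_near:
  "h < height t \<Longrightarrow> spine d h t = t # spine d h (near d t)"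
  "h < height t \<Longrightarrow> spine_end d h t = spine_end d h (near d t)"
  "\<not> h < height t \<Longrightarrow> spine d h t = []"
  "\<not> h < height t \<Longrightarrow> spine_end d h t = t"
  by (cases t; cases d; simp)+

lemma down_loop:
  fixes d :: bool
  assumes "constants s" "has_tree s item (regs s 18) t" "regs s 19 = height t"
  shows "\<exists>s'. run (WhileLess 17 19 (down_step d)) (9 * length (spine d (regs s 17) t) + 1) s s' \<and>
    has_tree s' item (regs s' 18) (spine_end d (regs s 17) t) \<and>
    has_trees s' item (regs s 2) (spine d (regs s 17) t) \<and>
    regs s' 2 = regs s 2 + length (spine d (regs s 17) t) \<and>
    extends s s' \<and> (\<forall>r. r \<notin> {2,6,7,18,19} \<longrightarrow> regs s' r = regs s r)"
  using assms
proof (induction "height t" arbitrary: s t rule: less_induct)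
  case less
  show ?case
  proof (cases "regs s 17 < height t")
    case False
    then show ?thesis using run_while_false[of s 17 19 "down_step d"] less.prems
      by (intro exI[of _ s]) (simp add: spine_near has_trees_def)
  next
    case True
    define s1 where "s1 = effect (down_step d) s"
    have r1: "run (down_step d) 8 s s1" unfolding s1_def by (rule run_effect) (auto simp: down_step_def)
    note D = down_step[OF less.prems(1,2), of d, folded s1_def]
    have c: "constants s1" using D(6) less.prems(1) True by (auto simp: constants_def)
    have "height (near d t) < height t" using True by (cases t) auto
    from less.hyps[OF this c D(1) D(2)] True D(6) obtain s' where
     s': "run (WhileLess 17 19 (down_step d)) (9 * length (spine d (regs s 17) (near d t)) + 1) s1 s'"
      "has_tree s' item (regs s' 18) (spine_end d (regs s 17) (near d t))"
      "has_trees s' item (regs s1 2) (spine d (regs s 17) (near d t))"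
      "regs s' 2 = regs s1 2 + length (spine d (regs s 17) (near d t))"
      "extends s1 s'" "\<forall>r. r \<notin> {2,6,7,18,19} \<longrightarrow> regs s' r = regs s1 r" by auto
    have e: "extends s s'" using extends_trans D(5) s'(5) True by auto
    have m: "mem s' (regs s 2) = regs s 18" using s'(5) D(3,4) True by (auto simp: extends_def)
    have "run (WhileLess 17 19 (down_step d)) (Suc (8 + (9 * length (spine d (regs s 17) (near d t)) + 1))) s s'"
      using run_while_true[OF _ r1 s'(1)] less.prems(3) True by simp
    moreover have "has_trees s' item (regs s 2) (spine d (regs s 17) t)"
      using True s'(3,4) D(3) m has_tree_extends[OF e less.prems(2)]
      by (auto simp: spine_near has_trees_def nth_Cons split: nat.split)
    ultimately show ?thesis using s' e D(3,6) True
      by (intro exI[of _ s']) (auto simp: spine_near)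
  qed
qed

text \<open>The first loop stacks the spine at the free address, the second one pops it. The stack is never
  deallocated, so that the new nodes lie above it.\<close>

definition graft_com :: "bool \<Rightarrow> com" where
  "graft_com d = (Load 17 8 ;; Copy 12 2 ;; Load 19 18) ;; WhileLess 17 19 (down_step d) ;;
    (Copy 11 2 ;; Copy 9 18 ;; Copy 10 20) ;; WhileLess 12 11 (up_step d) ;;
    IfLess 23 10 (alloc2 d 8 8 9) Skip"

text \<open>Each of the \<open>k - h\<close> spine nodes is pushed once in at most 9 steps and
  popped once in at most 41. The remaining 21 steps are set-up, the two final loop tests and the
  possible new root.\<close>

lemma graft_com:
  fixes d :: bool
  assumes "constants s" "full h x" "full k t" "h \<le> k" "has_tree s item (regs s 8) x" "has_tree s item (regs s 18) t"
  shows "\<exists>s'. run (graft_com d) (50 * (k - h) + 21) s s' \<and> has_tree s' item (regs s' 8) (graft d x t) \<and>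
    extends s s' \<and> (\<forall>r\<ge>20. regs s' r = regs s r)"
proof -
  define c1 where "c1 = (Load 17 8 ;; Copy 12 2 ;; Load 19 18)"
  define s1 where "s1 = effect c1 s"
  have r1: "run c1 3 s s1" unfolding s1_def by (rule run_effect) (auto simp: c1_def)
  have s1: "regs s1 17 = h" "regs s1 12 = regs s 2" "regs s1 19 = height t"
    "\<forall>r. r \<notin> {17,12,19} \<longrightarrow> regs s1 r = regs s r" "mem s1 = mem s"
    using has_tree_height[OF assms(5)] has_tree_height[OF assms(6)] full_height[OF assms(2)]
    unfolding s1_def c1_def by auto
  have c: "constants s1" using s1(4) assms(1) by (auto simp: constants_def)
  have e1: "extends s s1" using s1 by (auto simp: extends_def)
  have "has_tree s1 item (regs s1 18) t" using s1 assms(6) by (auto simp: has_tree_def)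
  from down_loop[OF c this s1(3), of d] obtain s2 where
    r2: "run (WhileLess 17 19 (down_step d)) (9 * length (spine d h t) + 1) s1 s2" and
    s2: "has_tree s2 item (regs s2 18) (spine_end d h t)"
    "has_trees s2 item (regs s1 2) (spine d h t)" "regs s2 2 = regs s1 2 + length (spine d h t)"
    "extends s1 s2" "\<forall>r. r \<notin> {2,6,7,18,19} \<longrightarrow> regs s2 r = regs s1 r" unfolding s1 by blast
  define c3 where "c3 = (Copy 11 2 ;; Copy 9 18 ;; Copy 10 20)"
  define s3 where "s3 = effect c3 s2"
  have r3: "run c3 3 s2 s3" unfolding s3_def by (rule run_effect) (auto simp: c3_def)
  have s3: "regs s3 11 = regs s2 2" "regs s3 9 = regs s2 18" "regs s3 10 = 1"
    "\<forall>r. r \<notin> {11,9,10} \<longrightarrow> regs s3 r = regs s2 r" "mem s3 = mem s2"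
    using s2(5) c unfolding s3_def c3_def constants_def by auto
  have e3: "extends s s3" using extends_trans[OF e1 s2(4)] s3 by (auto simp: extends_def)
  have hi: "\<forall>r\<ge>20. regs s3 r = regs s r" using s1(4) s2(5) s3(4) by simp
  have c': "constants s3" using constants_cong hi assms(1) by blast
  define R where "R = (x, Some (spine_end d h t))"
  note fs = full_spine[OF assms(3,4), of d]
  have "has_result s3 item R" using s1(4) s2(1,5) s3 has_tree_extends[OF e3 assms(5)] by (auto simp: R_def has_tree_def)
  moreover have "full_res h R" using fs assms(2) by (auto simp: R_def)
  moreover have "\<forall>i < length (spine d h t). full (h + length (spine d h t) - i) (spine d h t ! i)"
    using fs assms(4) by auto
  moreover have "has_trees s3 item (regs s3 12) (spine d h t)"
    using s2(2,5) s1 s3 by (auto simp: has_trees_def has_tree_def)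
  moreover have "regs s3 11 = regs s3 12 + length (spine d h t)"
    using s2(3,5) s1 s3 by auto
  moreover have fR: "foldr (absorb d) (spine d h t) R = insert_spine d x t"
    using full_height[OF assms(2)] by (simp add: insert_spine_def R_def)
  moreover have len: "length (spine d h t) = k - h" using fs by simp
  ultimately obtain s4 where r4: "run (WhileLess 12 11 (up_step d)) (41 * (k - h) + 1) s3 s4" and
    s4: "has_result s4 item (insert_spine d x t)" "full_res k (insert_spine d x t)" "extends s3 s4"
     "\<forall>r\<ge>20. regs s4 r = regs s3 r"
    using up_loop[OF c', of "spine d h t" h R item d] assms(4) by auto
  define c5 where "c5 = IfLess 23 10 (alloc2 d 8 8 9) Skip"
  define s5 where "s5 = effect c5 s4"
  have r5: "run c5 13 s4 s5" unfolding s5_def by (rule run_effect) (auto simp: c5_def)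
  obtain a b where ab: "insert_spine d x t = (a, b)" by force
  have c4: "constants s4" using constants_cong s4(4) c' by blast
  have s5: "has_tree s5 item (regs s5 8) (graft d x t) \<and> extends s4 s5 \<and> (\<forall>r\<ge>20. regs s5 r = regs s4 r)"
  proof (cases b)
    case None
    then show ?thesis using s4 ab c4 by (auto simp: s5_def c5_def graft_def constants_def)
  next
    case (Some u)
    have eq: "s5 = effect (alloc2 d 8 8 9) s4" using s4(1) c4 Some ab
      by (auto simp: s5_def c5_def constants_def)
    from alloc2[OF c4, of k a u item 8 9 8 d] show ?thesis unfolding eq
      using s4(1,2) ab Some by (auto simp: graft_def)
  qed
  have "run (graft_com d) (3 + ((9 * length (spine d h t) + 1) + (3 + ((41 * (k - h) + 1) + 13)))) s s5"
    unfolding graft_com_def by (fold c1_def c3_def c5_def) (rule run_seq[OF r1 run_seq[OF r2 run_seq[OF r3 run_seq[OF r4 r5]]]])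
  then have "run (graft_com d) (50 * (k - h) + 21) s s5"
    by (rule run_mono) (simp add: len)
  then show ?thesis using s5 extends_trans[OF extends_trans[OF e3 s4(3)], of s5] s4(4) hi
    by (intro exI[of _ s5]) auto
qed

definition join_com :: com where
  "join_com = (Load 6 8 ;; Load 7 18) ;;
     IfLess 7 6 ((Copy 6 8 ;; Copy 8 18 ;; Copy 18 6) ;; graft_com False) (graft_com True)"

lemma join_com:
  assumes "constants s" "full h x" "full k y" "has_tree s item (regs s 8) x" "has_tree s item (regs s 18) y"
  shows "\<exists>s'. run join_com (50 * (max h k - min h k) + 27) s s' \<and> has_tree s' item (regs s' 8) (join x y) \<and>
    extends s s' \<and> (\<forall>r\<ge>20. regs s' r = regs s r)"
proof -
  define c1 where "c1 = (Load 6 8 ;; Load 7 18)"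
  define s1 where "s1 = effect c1 s"
  have r1: "run c1 2 s s1" unfolding s1_def by (rule run_effect) (auto simp: c1_def)
  have s1: "regs s1 6 = h" "regs s1 7 = k" "\<forall>r. r \<notin> {6,7} \<longrightarrow> regs s1 r = regs s r" "mem s1 = mem s"
    using has_tree_height[OF assms(4)] has_tree_height[OF assms(5)] full_height[OF assms(2)] full_height[OF assms(3)]
    unfolding s1_def c1_def by auto
  have c: "constants s1" using s1(3) assms(1) by (auto simp: constants_def)
  have e1: "extends s s1" using s1 by (auto simp: extends_def)
  show ?thesis
  proof (cases "k < h")
    case True
    define c2 where "c2 = (Copy 6 8 ;; Copy 8 18 ;; Copy 18 6)"
    define s2 where "s2 = effect c2 s1"
    have r2: "run c2 3 s1 s2" unfolding s2_def by (rule run_effect) (auto simp: c2_def)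
    have s2: "regs s2 8 = regs s 18" "regs s2 18 = regs s 8"
      "\<forall>r. r \<notin> {6,7,8,18} \<longrightarrow> regs s2 r = regs s r" "mem s2 = mem s"
      using s1 unfolding s2_def c2_def by auto
    have c': "constants s2" using s2(3) assms(1) by (auto simp: constants_def)
    have e2: "extends s s2" using s2 by (auto simp: extends_def)
    obtain s3 where r3: "run (graft_com False) (50 * (h - k) + 21) s2 s3"
      and s3: "has_tree s3 item (regs s3 8) (graft False y x)" "extends s2 s3" "\<forall>r\<ge>20. regs s3 r = regs s2 r"
      using graft_com[OF c' assms(3,2), of item False] True has_tree_extends[OF e2 assms(4)] has_tree_extends[OF e2 assms(5)] s2
      by auto
    have "run join_com (2 + Suc (3 + (50 * (h - k) + 21))) s s3"
      unfolding join_com_def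
      by (fold c1_def, rule run_seq[OF r1], rule run_if, simp only: s1 True if_True, fold c2_def, rule run_seq[OF r2 r3])
    then have "run join_com (50 * (max h k - min h k) + 27) s s3"
      by (rule run_mono) (use True in auto)
    then show ?thesis using True s3 extends_trans[OF e2 s3(2)] s2(3) full_height[OF assms(2)] full_height[OF assms(3)]
      by (intro exI[of _ s3]) (auto simp: join_def)
  next
    case False
    obtain s3 where r3: "run (graft_com True) (50 * (k - h) + 21) s1 s3"
      and s3: "has_tree s3 item (regs s3 8) (graft True x y)" "extends s1 s3" "\<forall>r\<ge>20. regs s3 r = regs s1 r"
      using graft_com[OF c assms(2,3), of item True] False has_tree_extends[OF e1 assms(4)] has_tree_extends[OF e1 assms(5)] s1
      by auto
    have "run join_com (2 + Suc (50 * (k - h) + 21)) s s3"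
      unfolding join_com_def
      by (fold c1_def, rule run_seq[OF r1], rule run_if, simp add: s1 False r3)
    then have "run join_com (50 * (max h k - min h k) + 27) s s3"
      by (rule run_mono) (use False in auto)
    then show ?thesis using False s3 extends_trans[OF e1 s3(2)] s1(3) full_height[OF assms(2)] full_height[OF assms(3)]
      by (intro exI[of _ s3]) (auto simp: join_def)
  qed
qed

section \<open>The program for slices\<close>

text \<open>The list is in the order of reading, so for a pass from the right it is the reverse of
  the section of the array. Both passes shrink the same section, and the second one continues with
  what the first has left.\<close>

definition has_array :: "bool \<Rightarrow> state \<Rightarrow> (nat \<Rightarrow> 'a) \<Rightarrow> 'a tree23 list \<Rightarrow> bool" where
  "has_array d s item ts \<longleftrightarrow> has_trees s item (regs s 24) (if d then ts else rev ts) \<and>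
     regs s 25 = regs s 24 + length ts"

definition peek :: "bool \<Rightarrow> com" where
  "peek d = (if d then Load 28 24 else Sub 6 25 20 ;; Load 28 6)"

definition advance :: "bool \<Rightarrow> com" where
  "advance d = (if d then Add 24 24 20 else Sub 25 25 20)"

definition compare :: com where
  "compare = (Load 6 28 ;; Add 6 6 20 ;; Load 7 26)"

definition place :: "bool \<Rightarrow> com" where
  "place d = (if d then Copy 8 26 ;; Copy 18 28 else Copy 8 28 ;; Copy 18 26)"

definition gather_step :: "bool \<Rightarrow> com" where
  "gather_step d = (peek d ;; compare) ;; IfLess 6 7 (if d then Copy 27 24 else Copy 27 25)
     ((advance d ;; place d) ;; join_com ;; Copy 26 8)"

text \<open>Register 27 is a private loop bound that starts at the far end of the unread section. A
  loop can be left only through its guard, so the stopping branch moves this bound to the near end;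
  the section itself stays intact for the second pass.\<close>

definition gather_loop :: "bool \<Rightarrow> com" where
  "gather_loop d = (if d then WhileLess 24 27 (gather_step d) else WhileLess 27 25 (gather_step d))"

definition gather_com :: "bool \<Rightarrow> com" where
  "gather_com d = (peek d ;; advance d ;; Copy 26 28 ;; (if d then Copy 27 25 else Copy 27 24)) ;;
     gather_loop d"

lemma peek:
  fixes d :: bool
  assumes "constants s" "has_array d s item (t # ts)"
  defines "s' \<equiv> effect (peek d) s"
  shows "has_tree s item (regs s' 28) t" "mem s' = mem s" "\<forall>r. r \<notin> {6,28} \<longrightarrow> regs s' r = regs s r"
proof -
  show "mem s' = mem s" "\<forall>r. r \<notin> {6,28} \<longrightarrow> regs s' r = regs s r"
    unfolding s'_def peek_def by auto
  show "has_tree s item (regs s' 28) t"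
    using assms(1,2) unfolding s'_def peek_def constants_def has_array_def has_trees_def
    by (cases d; force dest: spec[of _ 0] spec[of _ "length ts"] simp: nth_append)
qed

lemma advance:
  fixes d :: bool
  assumes "constants s" "has_array d s item (t # ts)"
  defines "s' \<equiv> effect (advance d) s"
  shows "has_array d s' item ts"
proof (cases d)
  case True
  have "has_tree s item (mem s (Suc (regs s 24 + i))) (ts ! i)" if "i < length ts" for i
    using assms(2) that True by (auto simp: has_array_def has_trees_def dest!: spec[of _ "Suc i"])
  then show ?thesis using assms(1,2) True unfolding s'_def advance_def constants_def has_array_def has_trees_def
    by (auto simp: has_tree_def)
next
  case False
  have "has_tree s item (mem s (regs s 24 + i)) (rev ts ! i)" if "i < length ts" for i
    using assms(2) that False by (auto simp: has_array_def has_trees_def nth_append dest!: spec[of _ i])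
  then show ?thesis using assms(1,2) False unfolding s'_def advance_def constants_def has_array_def has_trees_def
    by (auto simp: has_tree_def)
qed

lemma has_array_cong:
  "extends s s' \<Longrightarrow> regs s' 24 = regs s 24 \<Longrightarrow> regs s' 25 = regs s 25 \<Longrightarrow> has_array d s item ts \<Longrightarrow> has_array d s' item ts"
  unfolding has_array_def using has_trees_extends by metis

lemma gather_loop_exit:
  "regs s 27 = (if d then regs s 24 else regs s 25) \<Longrightarrow> run (gather_loop d) 1 s s"
  unfolding gather_loop_def using run_while_false[of s] by auto

lemma gather_loop_step:
  assumes "has_array d s item (t # ts)" "regs s 27 = (if d then regs s 25 else regs s 24)"
    "run (gather_step d) T s s1" "run (gather_loop d) U s1 s'"
  shows "run (gather_loop d) (Suc (T + U)) s s'"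
  using assms unfolding gather_loop_def has_array_def
  by (cases d) (auto intro!: run_while_true)

text \<open>A joining iteration takes at most 50 steps per level of height difference plus 38, and
  \<open>gather_cost\<close> counts one unit per level plus one, so 60 steps per unit
  suffice.\<close>

lemma gather_loop:
  fixes d :: bool
  assumes "constants s" "\<exists>h. full h a" "\<forall>t \<in> set ts. \<exists>k. full k t" "has_tree s item (regs s 26) a" "has_array d s item ts"
    "regs s 27 = (if d then regs s 25 else regs s 24)" "gather d a ts = (a', rest)"
  shows "\<exists>s'. run (gather_loop d) (60 * gather_cost d a ts + 1) s s' \<and> has_tree s' item (regs s' 26) a' \<and>
    has_array d s' item rest \<and> extends s s' \<and> (\<forall>r. r \<ge> 20 \<and> r \<notin> {24..28} \<longrightarrow> regs s' r = regs s r)"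
  using assms
proof (induction ts arbitrary: s a)
  case Nil
  have "run (gather_loop d) 1 s s" by (rule gather_loop_exit) (use Nil in \<open>auto simp: has_array_def\<close>)
  then show ?case using Nil by (intro exI[of _ s]) auto
next
  case (Cons t ts)
  obtain h k where hk: "full h a" "full k t" using Cons.prems by auto
  then have ht: "height a = h" "height t = k" by (auto simp: full_height)
  define s1 where "s1 = effect (peek d ;; compare) s"
  define s0 where "s0 = effect (peek d) s"
  note P = peek[OF Cons.prems(1,5), folded s0_def]
  have r1: "run (peek d ;; compare) 5 s s1" unfolding s1_def
    by (rule run_effect) (auto simp: peek_def compare_def)
  have s1: "regs s1 28 = regs s0 28" "regs s1 6 = Suc k" "regs s1 7 = h" "mem s1 = mem s"
    "\<forall>r. r \<notin> {6,7,28} \<longrightarrow> regs s1 r = regs s r"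
  proof -
    have s10: "s1 = effect compare s0" by (simp add: s1_def s0_def)
    have "regs s0 20 = 1" "mem s (regs s0 28) = k" "mem s (regs s0 26) = h"
      using P Cons.prems(1,4) has_tree_height[OF P(1)] has_tree_height[OF Cons.prems(4)] ht
      by (auto simp: constants_def)
    then show "regs s1 28 = regs s0 28" "regs s1 6 = Suc k" "regs s1 7 = h" "mem s1 = mem s"
      "\<forall>r. r \<notin> {6,7,28} \<longrightarrow> regs s1 r = regs s r"
      using P(2,3) unfolding s10 compare_def by auto
  qed
  have c1: "constants s1" using s1(5) Cons.prems(1) by (auto simp: constants_def)
  have e1: "extends s s1" using s1 by (auto simp: extends_def)
  have a1: "has_array d s1 item (t # ts)" by (rule has_array_cong[OF e1 _ _ Cons.prems(5)]) (use s1 in auto)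
  have t1: "has_tree s1 item (regs s1 28) t" using has_tree_extends[OF e1 P(1)] s1 by auto
  have acc1: "has_tree s1 item (regs s1 26) a" using has_tree_extends[OF e1 Cons.prems(4)] s1 by auto
  show ?case
  proof (cases "Suc k < h")
    case True
    define s2 where "s2 = effect (if d then Copy 27 24 else Copy 27 25) s1"
    have s2: "regs s2 27 = (if d then regs s2 24 else regs s2 25)" "mem s2 = mem s1"
      "\<forall>r. r \<noteq> 27 \<longrightarrow> regs s2 r = regs s1 r"
      by (auto simp: s2_def)
    have "run (gather_step d) (5 + Suc 1) s s2" unfolding gather_step_def
      by (rule run_seq[OF r1], rule run_if, simp only: s1 True if_True, unfold s2_def, rule run_effect) auto
    from gather_loop_step[OF Cons.prems(5,6) this gather_loop_exit[OF s2(1)]]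
    have "run (gather_loop d) (60 * gather_cost d a (t # ts) + 1) s s2"
      by (rule run_mono) (use True ht in auto)
    moreover have e12: "extends s1 s2" using s2 by (auto simp: extends_def)
    moreover have "has_array d s2 item (t # ts)"
      by (rule has_array_cong[OF e12 _ _ a1]) (use s2 in auto)
    ultimately show ?thesis using has_tree_extends[OF e12 acc1] s2 s1 Cons.prems(7) True ht extends_trans[OF e1 e12]
      by (intro exI[of _ s2]) auto
  next
    case False
    define s2 where "s2 = effect (advance d) s1"
    define s3 where "s3 = effect (place d) s2"
    have r3: "run (advance d ;; place d) 3 s1 s3"
      using run_effect[of "advance d ;; place d" 3 s1] by (auto simp: s3_def s2_def advance_def place_def)
    have s2: "mem s2 = mem s1" "\<forall>r. r \<noteq> 24 \<and> r \<noteq> 25 \<longrightarrow> regs s2 r = regs s1 r"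
      "regs s2 (if d then 25 else 24) = regs s1 (if d then 25 else 24)"
      by (auto simp: s2_def advance_def)
    have e12: "extends s1 s2" using s2 by (auto simp: extends_def)
    have a2: "has_array d s2 item ts" using advance[OF c1 a1] s2_def by auto
    have s3: "mem s3 = mem s2" "\<forall>r. r \<noteq> 8 \<and> r \<noteq> 18 \<longrightarrow> regs s3 r = regs s2 r"
      "regs s3 8 = (if d then regs s1 26 else regs s1 28)" "regs s3 18 = (if d then regs s1 28 else regs s1 26)"
      using s2 by (auto simp: s3_def place_def)
    have e23: "extends s2 s3" using s3 by (auto simp: extends_def)
    have e13: "extends s1 s3" using extends_trans[OF e12 e23] .
    have a3: "has_array d s3 item ts" by (rule has_array_cong[OF e23 _ _ a2]) (use s3 in auto)
    have c3: "constants s3" using c1 s2 s3 by (auto simp: constants_def)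
    have t3: "has_tree s3 item (regs s1 28) t" "has_tree s3 item (regs s1 26) a" using has_tree_extends[OF e13] t1 acc1 by auto
    obtain s4 where s4: "run join_com (50 * (max h k - min h k) + 27) s3 s4" "has_tree s4 item (regs s4 8) (join_dir d a t)"
      "extends s3 s4" "\<forall>r\<ge>20. regs s4 r = regs s3 r"
    proof (cases d)
      case True
      then show ?thesis using join_com[OF c3 hk(1,2), of item] t3 s3 that by (auto simp: join_dir_def)
    next
      case False
      then show ?thesis using join_com[OF c3 hk(2,1), of item] t3 s3 that
        by (auto simp: join_dir_def max.commute min.commute)
    qed
    define s5 where "s5 = set_reg 26 (regs s4 8) s4"
    have r5: "run (Copy 26 8) 1 s4 s5" using run_effect[of "Copy 26 8" 1 s4] by (auto simp: s5_def)
    have s5: "mem s5 = mem s4" "\<forall>r. r \<noteq> 26 \<longrightarrow> regs s5 r = regs s4 r" "regs s5 26 = regs s4 8"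
      by (auto simp: s5_def)
    have e45: "extends s4 s5" using s5 by (auto simp: extends_def)
    have e35: "extends s3 s5" using extends_trans[OF s4(3) e45] .
    have a5: "has_array d s5 item ts" by (rule has_array_cong[OF e35 _ _ a3]) (use s4 s5 in auto)
    have c5: "constants s5" using c3 s4(4) s5 by (auto simp: constants_def)
    have acc5: "has_tree s5 item (regs s5 26) (join_dir d a t)" using has_tree_extends[OF e45 s4(2)] s5 by auto
    have lim: "regs s5 27 = (if d then regs s5 25 else regs s5 24)"
      using Cons.prems(6) s1(5) s2 s3 s4(4) s5 by (cases d) auto
    have "\<exists>h. full h (join_dir d a t)" using join_dir_spec(2)[OF hk, of d] by blast
    moreover have "gather d (join_dir d a t) ts = (a', rest)" using Cons.prems(7) False ht by auto
    ultimately obtain s' where s': "run (gather_loop d) (60 * gather_cost d (join_dir d a t) ts + 1) s5 s'"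
      "has_tree s' item (regs s' 26) a'" "has_array d s' item rest" "extends s5 s'"
      "\<forall>r. r \<ge> 20 \<and> r \<notin> {24..28} \<longrightarrow> regs s' r = regs s5 r"
      using Cons.IH[OF c5 _ _ acc5 a5 lim] Cons.prems(3) by auto
    have "run (gather_step d) (5 + Suc (3 + (50 * (max h k - min h k) + 27 + 1))) s s5" unfolding gather_step_def
      by (rule run_seq[OF r1], rule run_if, simp only: s1 False if_False, rule run_seq[OF r3 run_seq[OF s4(1) r5]])
    from gather_loop_step[OF Cons.prems(5,6) this s'(1)]
    have "run (gather_loop d) (60 * gather_cost d a (t # ts) + 1) s s'"
      by (rule run_mono) (use False ht in auto)
    moreover have "extends s s'" using extends_trans[OF e1 extends_trans[OF e13 extends_trans[OF e35 s'(4)]]] .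
    moreover have "\<forall>r. r \<ge> 20 \<and> r \<notin> {24..28} \<longrightarrow> regs s' r = regs s r"
      using s'(5) s5(2) s4(4) s3(2) s2(2) s1(5) by auto
    ultimately show ?thesis using s' by blast
  qed
qed

lemma gather_com:
  fixes d :: bool
  assumes "constants s" "\<forall>t \<in> set (t # ts). \<exists>k. full k t" "has_array d s item (t # ts)"
    "gather d t ts = (a', rest)"
  shows "\<exists>s'. run (gather_com d) (60 * gather_cost d t ts + 6) s s' \<and> has_tree s' item (regs s' 26) a' \<and>
    has_array d s' item rest \<and> extends s s' \<and> (\<forall>r. r \<ge> 20 \<and> r \<notin> {24..28} \<longrightarrow> regs s' r = regs s r)"
proof -
  define s1 where "s1 = effect (peek d) s"
  note s1 = peek[OF assms(1,3), folded s1_def]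
  have e1: "extends s s1" using s1 by (auto simp: extends_def)
  have a1: "has_array d s1 item (t # ts)" by (rule has_array_cong[OF e1 _ _ assms(3)]) (use s1 in auto)
  have c1: "constants s1" using s1(3) assms(1) by (auto simp: constants_def)
  define s2 where "s2 = effect (advance d) s1"
  have s2: "mem s2 = mem s1" "\<forall>r. r \<noteq> 24 \<and> r \<noteq> 25 \<longrightarrow> regs s2 r = regs s1 r"
    by (auto simp: s2_def advance_def)
  have a2: "has_array d s2 item ts" using advance[OF c1 a1] s2_def by auto
  have e12: "extends s1 s2" using s2 by (auto simp: extends_def)
  define c where "c = (peek d ;; advance d ;; Copy 26 28 ;; (if d then Copy 27 25 else Copy 27 24))"
  define s3 where "s3 = effect c s"
  have s3: "mem s3 = mem s2" "\<forall>r. r \<noteq> 26 \<and> r \<noteq> 27 \<longrightarrow> regs s3 r = regs s2 r"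
    "regs s3 26 = regs s2 28" "regs s3 27 = (if d then regs s3 25 else regs s3 24)"
    by (auto simp: s3_def c_def s1_def s2_def)
  have e23: "extends s2 s3" using s3 by (auto simp: extends_def)
  have a3: "has_array d s3 item ts" by (rule has_array_cong[OF e23 _ _ a2]) (use s3 in auto)
  have e13: "extends s s3" using extends_trans[OF e1 extends_trans[OF e12 e23]] .
  have acc: "has_tree s3 item (regs s3 26) t" using has_tree_extends[OF e13 s1(1)] s2 s3 by auto
  have c3: "constants s3" using c1 s2 s3 by (auto simp: constants_def)
  have r: "run c 5 s s3" unfolding s3_def by (rule run_effect) (auto simp: c_def peek_def advance_def)
  obtain s' where s': "run (gather_loop d) (60 * gather_cost d t ts + 1) s3 s'" "has_tree s' item (regs s' 26) a'"
    "has_array d s' item rest" "extends s3 s'" "\<forall>r. r \<ge> 20 \<and> r \<notin> {24..28} \<longrightarrow> regs s' r = regs s3 r"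
    using gather_loop[OF c3 _ _ acc a3 s3(4) assms(4)] assms(2) by auto
  have "run (gather_com d) (5 + (60 * gather_cost d t ts + 1)) s s'"
    unfolding gather_com_def by (fold c_def) (rule run_seq[OF r s'(1)])
  then have "run (gather_com d) (60 * gather_cost d t ts + 6) s s'" by (rule run_mono) simp
  moreover have "\<forall>r. r \<ge> 20 \<and> r \<notin> {24..28} \<longrightarrow> regs s' r = regs s r"
    using s'(5) s3(2) s2(2) s1(3) by auto
  ultimately show ?thesis using s' extends_trans[OF e13 s'(4)] by blast
qed

definition init_com :: com where
  "init_com = (SetConst 20 1 ;; SetConst 21 2 ;; SetConst 22 3 ;; SetConst 23 0 ;; Copy 24 0 ;; Add 25 0 1)"

definition finish_com :: com where
  "finish_com = ((gather_com False ;; Copy 8 29 ;; Copy 18 26) ;; join_com)"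

definition join_slice :: com where
  "join_slice = init_com ;; (gather_com True ;; Copy 29 26) ;; IfLess 24 25 finish_com (Copy 8 26) ;; Copy 0 8"

section \<open>Both passes over the slice together\<close>

lemma staircase_appendD: "staircase (xs @ ys) \<Longrightarrow> staircase xs"
  by (induction xs rule: staircase.induct) (auto split: list.splits, (cases ys; force)+)

text \<open>A bound on the length is enough, because what \<open>gather\<close> leaves over is a
  suffix of its input: the pass has then consumed all of \<open>us\<close>.\<close>

lemma gather_length:
  assumes "\<forall>t \<in> set (t # ts). \<exists>k. full k t" "t # ts = us @ vs" "staircase (map height us)"
  shows "length (snd (gather d t ts)) \<le> length vs"
proof (cases us)
  case Nil
  have "length (snd (gather d a ts)) \<le> length ts" for a
    by (induction ts arbitrary: a) (auto intro: le_SucI)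
  then show ?thesis using assms(2) Nil le_SucI by fastforce
next
  case (Cons u us')
  then have u: "u = t" "ts = us' @ vs" using assms(2) by auto
  obtain h where h: "full h t" using assms(1) by auto
  show ?thesis unfolding u(2)
    \<comment> \<open>At the start the accumulated tree is itself the last tree read, so its height
      is \<open>p\<close> and the premise about height \<open>Suc p\<close> is vacuous.\<close>
    by (rule gather_staircase[OF h, where p = h]) (use assms Cons u full_height[OF h] in auto)
qed

text \<open>The split into \<open>us\<close> and \<open>vs\<close> exists only in the proof. The
  first pass may run beyond \<open>us\<close> but not stop inside it, so the unread trees are a
  suffix of \<open>vs\<close>. Read from the right they form a staircase, and the second pass leaves
  nothing.\<close>

lemma join_slice_run:
  assumes in1: "regs s 1 = length ts" "regs s 0 + length ts \<le> regs s 2" "ts \<noteq> []"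
    "\<forall>i < length ts. stored (mem s) item (regs s 2) (mem s (regs s 0 + i)) (ts ! i)"
    and H: "\<forall>t \<in> set ts. \<exists>k\<le>H. full k t"
    and g: "ts = us @ vs" "staircase (map height us)" "staircase (rev (map height vs))"
    and len: "length ts \<le> 4 * Suc H"
  shows "\<exists>s' T' h. run join_slice (2000 * Suc H) s s' \<and> full h T' \<and> items T' = concat (map items ts) \<and>
    stored (mem s') item (regs s' 2) (regs s' 0) T'"
proof -
  obtain t ts' where ts: "ts = t # ts'" using in1(3) by (cases ts) auto
  have H': "\<forall>t \<in> set ts. \<exists>k. full k t" using H by blast
  define s1 where "s1 = effect init_com s"
  have r1: "run init_com 6 s s1" unfolding s1_def by (rule run_effect) (auto simp: init_com_def)
  have s1: "constants s1" "mem s1 = mem s" "regs s1 2 = regs s 2" "regs s1 24 = regs s 0"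
    "regs s1 25 = regs s 0 + length ts"
    using in1(1) by (auto simp: s1_def init_com_def constants_def)
  have a1: "has_array True s1 item (t # ts')"
    using in1 s1 by (auto simp: has_array_def has_trees_def has_tree_def simp flip: ts)
  obtain a rest where ph: "gather True t ts' = (a, rest)" by force
  obtain s2 where r2: "run (gather_com True) (60 * gather_cost True t ts' + 6) s1 s2"
    and s2: "has_tree s2 item (regs s2 26) a" "has_array True s2 item rest" "extends s1 s2"
      "\<forall>r. r \<ge> 20 \<and> r \<notin> {24..28} \<longrightarrow> regs s2 r = regs s1 r"
    using gather_com[OF s1(1) _ a1 ph] H' ts by blast
  obtain h0 where h0: "full h0 t" "h0 \<le> H" using H ts by auto
  obtain n ha where ha: "rest = drop n ts'" "full ha a" "ha \<le> Suc (Suc H)"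
    "items a = items t @ concat (map items (take n ts'))"
    "gather_cost True t ts' \<le> ha + 2 * length ts' + 1"
    using gather_spec[OF h0(1), of ts' H True a rest] H h0(2) ph ts
    by (fastforce simp: append_dir_def items_dir_def)
  \<comment> \<open>The final height is at most \<open>H + 2\<close>, and each of at most
    \<open>4 * Suc H\<close> trees is charged 2.\<close>
  have cost1: "gather_cost True t ts' \<le> 11 * Suc H" using ha(3,5) len ts by auto
  have items1: "items a @ concat (map items rest) = concat (map items ts)"
    unfolding ts ha(1) ha(4) by (metis append.assoc append_take_drop_id concat.simps(2) concat_append list.simps(9) map_append)
  have "length rest \<le> length vs"
    using gather_length[of t ts' us vs True] H' g ts ph by auto
  then have rest: "\<exists>m. rest = drop m vs"
  proof -
    have "rest = drop (length ts - length rest) ts" unfolding ts ha(1) by (cases "n \<le> length ts'") auto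
    also have "\<dots> = drop (length ts - length rest - length us) vs"
      using \<open>length rest \<le> length vs\<close> g(1) by simp
    finally show ?thesis by blast
  qed
  define s3 where "s3 = effect (Copy 29 26) s2"
  have r3: "run (Copy 29 26) 1 s2 s3" unfolding s3_def by (rule run_effect) auto
  have s3: "regs s3 29 = regs s2 26" "mem s3 = mem s2" "\<forall>r. r \<noteq> 29 \<longrightarrow> regs s3 r = regs s2 r"
    by (auto simp: s3_def)
  have e23: "extends s2 s3" using s3 by (auto simp: extends_def)
  have a3: "has_array True s3 item rest" by (rule has_array_cong[OF e23 _ _ s2(2)]) (use s3 in auto)
  have acc3: "has_tree s3 item (regs s3 29) a" "has_tree s3 item (regs s3 26) a" using has_tree_extends[OF e23 s2(1)] s3 by auto
  have c3: "constants s3" using s1(1) s2(4) s3 by (auto simp: constants_def)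
  have r123: "run (gather_com True ;; Copy 29 26) (60 * gather_cost True t ts' + 6 + 1) s1 s3"
    by (rule run_seq[OF r2 r3])
  have "\<exists>s4 h T'. run (IfLess 24 25 finish_com (Copy 8 26)) (800 * Suc H + 50) s3 s4 \<and>
    has_tree s4 item (regs s4 8) T' \<and> full h T' \<and> items T' = concat (map items ts)"
  proof (cases rest rule: rev_cases)
    case Nil
    then have "\<not> regs s3 24 < regs s3 25" using a3 by (simp add: has_array_def)
    then have r: "run (IfLess 24 25 finish_com (Copy 8 26)) (Suc 1) s3 (effect (Copy 8 26) s3)"
      using run_effect[of "Copy 8 26" 1 s3] by (intro run_if) simp
    have "run (IfLess 24 25 finish_com (Copy 8 26)) (800 * Suc H + 50) s3 (effect (Copy 8 26) s3)"
      by (rule run_mono[OF r]) simp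
    moreover have "has_tree (effect (Copy 8 26) s3) item (regs (effect (Copy 8 26) s3) 8) a"
      using acc3 by (auto simp: has_tree_def)
    moreover have "items a = concat (map items ts)" using items1 Nil by simp
    ultimately show ?thesis using ha(2) by blast
  next
    case (snoc us2 u)
    define ws where "ws = rev us2"
    have rr: "rev rest = u # ws" using snoc ws_def by simp
    have a3': "has_array False s3 item (u # ws)"
      using a3 unfolding has_array_def by (simp flip: rr)
    have sub: "set (u # ws) \<subseteq> set ts"
      using arg_cong[OF rr, of set] ha(1) ts set_drop_subset[of n ts'] by auto
    obtain b rest2 where ph2: "gather False u ws = (b, rest2)" by force
    have fw: "\<forall>t \<in> set (u # ws). \<exists>k. full k t" using sub H' by blast
    obtain s4 where r4: "run (gather_com False) (60 * gather_cost False u ws + 6) s3 s4"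
      and s4: "has_tree s4 item (regs s4 26) b" "extends s3 s4"
        "\<forall>r. r \<ge> 20 \<and> r \<notin> {24..28} \<longrightarrow> regs s4 r = regs s3 r"
      using gather_com[OF c3 fw a3' ph2] by blast
    obtain h1 where h1: "full h1 u" "h1 \<le> H" using H sub by auto
    obtain n2 hb where hb: "rest2 = drop n2 ws" "full hb b" "hb \<le> Suc (Suc H)"
      "items b = append_dir False (items u) (items_dir False (take n2 ws))"
      "gather_cost False u ws \<le> hb + 2 * length ws + 1"
      using gather_spec[OF h1(1), of ws H False b rest2] H h1(2) ph2 sub by fastforce
    obtain m where m: "rest = drop m vs" using rest by blast
    \<comment> \<open>A suffix of \<open>vs\<close> becomes a prefix of the reversed list, and
      prefixes of staircases are staircases.\<close>
    have "rev (map height vs) = map height (u # ws) @ rev (map height (take m vs))"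
      unfolding rr[symmetric] m by (metis append_take_drop_id rev_append rev_map map_append)
    then have "staircase (map height (u # ws))" using g(3) staircase_appendD by metis
    then have "rest2 = []" using gather_length[OF fw, of "u # ws" "[]" False] ph2 by auto
    then have "items b = concat (map items rest)"
      using hb(1,4) rr by (simp add: append_dir_def items_dir_def rev_swap)
    then have itb: "items (join a b) = concat (map items ts)"
      using join_dir_spec(1)[OF ha(2) hb(2), of True] items1 by (simp add: join_dir_def append_dir_def)
    have lw: "length ws \<le> length ts'" using arg_cong[OF rr, of length] ha(1) by auto
    then have cost2: "gather_cost False u ws \<le> 11 * Suc H" using hb(3,5) len ts by auto
    define s5 where "s5 = effect (Copy 8 29 ;; Copy 18 26) s4"
    have r5: "run (Copy 8 29 ;; Copy 18 26) 2 s4 s5" unfolding s5_def by (rule run_effect) auto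
    have s5: "regs s5 8 = regs s4 29" "regs s5 18 = regs s4 26" "mem s5 = mem s4"
      "\<forall>r. r \<noteq> 8 \<and> r \<noteq> 18 \<longrightarrow> regs s5 r = regs s4 r" by (auto simp: s5_def)
    have e45: "extends s4 s5" using s5 by (auto simp: extends_def)
    have c5: "constants s5" using c3 s4(3) s5 by (auto simp: constants_def)
    have "has_tree s5 item (regs s5 8) a" "has_tree s5 item (regs s5 18) b"
      using has_tree_extends[OF extends_trans[OF s4(2) e45] acc3(1)] has_tree_extends[OF e45 s4(1)] s5 s4(3) by auto
    from join_com[OF c5 ha(2) hb(2) this] obtain s6 where
      r6: "run join_com (50 * (max ha hb - min ha hb) + 27) s5 s6" and
      s6: "has_tree s6 item (regs s6 8) (join a b)" by blast
    have "regs s3 24 < regs s3 25" using a3' by (simp add: has_array_def)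
    then have "run (IfLess 24 25 finish_com (Copy 8 26))
       (Suc ((60 * gather_cost False u ws + 6 + 2) + (50 * (max ha hb - min ha hb) + 27))) s3 s6"
      unfolding finish_com_def
      using run_seq[OF run_seq[OF r4 r5] r6] by (intro run_if) (simp add: add.assoc)
    \<comment> \<open>The second pass contributes \<open>660 * Suc H\<close>, the last join at most
      \<open>50 * (H + 2)\<close>, as neither height exceeds \<open>H + 2\<close>; the rest covers
      constants.\<close>
    then have "run (IfLess 24 25 finish_com (Copy 8 26)) (800 * Suc H + 50) s3 s6"
      by (rule run_mono) (use cost2 ha(3) hb(3) in auto)
    moreover obtain h where "full h (join a b)"
      using join_dir_spec(2)[OF ha(2) hb(2), of True] by (auto simp: join_dir_def)
    ultimately show ?thesis using s6 itb by blast
  qed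
  then obtain s4 h T' where r4: "run (IfLess 24 25 finish_com (Copy 8 26)) (800 * Suc H + 50) s3 s4" and
    s4: "has_tree s4 item (regs s4 8) T'" "full h T'" "items T' = concat (map items ts)" by blast
  define s5 where "s5 = effect (Copy 0 8) s4"
  have r5: "run (Copy 0 8) 1 s4 s5" unfolding s5_def by (rule run_effect) auto
  have "run join_slice (6 + ((60 * gather_cost True t ts' + 6 + 1) + ((800 * Suc H + 50) + 1))) s s5"
    unfolding join_slice_def by (rule run_seq[OF r1 run_seq[OF r123 run_seq[OF r4 r5]]])
  then have "run join_slice (2000 * Suc H) s s5" by (rule run_mono) (use cost1 in auto)
  moreover have "stored (mem s5) item (regs s5 2) (regs s5 0) T'"
    using s4(1) by (auto simp: s5_def has_tree_def)
  ultimately show ?thesis using s4 by blast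
qed

section \<open>Heights in a slice\<close>

lemma staircase_nth: "staircase xs \<Longrightarrow> i + 2 < length xs \<Longrightarrow> xs ! i < xs ! (i + 2)"
proof (induction xs arbitrary: i rule: staircase.induct)
  case (1 x y z zs)
  then show ?case by (cases i) auto
qed auto

text \<open>Every second entry increases strictly, so the entry at index \<open>i\<close> is at
  least about half of \<open>i\<close>. Since the last entry is at most \<open>H\<close>, the last
  index is at most \<open>2 * H + 1\<close>.\<close>

lemma staircase_length:
  assumes "staircase xs" "\<forall>x \<in> set xs. x \<le> H"
  shows "length xs \<le> 2 * Suc H"
proof -
  have *: "i < length xs \<Longrightarrow> i \<le> 2 * xs ! i + 1" for i
  proof (induction i rule: less_induct)
    case (less i)
    show ?case
    proof (cases "i < 2")
      case False
      then obtain j where j: "i = j + 2" by (metis add.commute le_Suc_ex not_less)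
      then show ?thesis using less.IH[of j] staircase_nth[OF assms(1), of j] less.prems by simp
    qed auto
  qed
  show ?thesis
  proof (cases xs rule: rev_cases)
    case (snoc ys y)
    then show ?thesis using *[of "length ys"] assms(2) by auto
  qed auto
qed

lemma staircase_snoc: "staircase xs \<Longrightarrow> xs = [g] \<or> (\<forall>x \<in> set xs. x < g) \<Longrightarrow> staircase (xs @ [g])"
  by (induction xs rule: staircase.induct) auto

lemma staircase_snoc_snoc: "staircase xs \<Longrightarrow> \<forall>x \<in> set xs. x < g \<Longrightarrow> staircase (xs @ [g, g])"
  by (induction xs rule: staircase.induct) auto

section \<open>Sets of consecutive list elements, and how they split at a concatenation\<close>

definition initial_part :: "'b list \<Rightarrow> 'b set \<Rightarrow> bool" where "initial_part xs A \<longleftrightarrow> (\<exists>n. A = set (take n xs))"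
definition final_part :: "'b list \<Rightarrow> 'b set \<Rightarrow> bool" where "final_part xs A \<longleftrightarrow> (\<exists>n. A = set (drop n xs))"
definition middle_part :: "'b list \<Rightarrow> 'b set \<Rightarrow> bool" where "middle_part xs A \<longleftrightarrow> (\<exists>i n. A = set (take n (drop i xs)))"

lemma image_set_eq: "inj f \<Longrightarrow> f ` A = set (map f xs) \<longleftrightarrow> A = set xs"
  by (auto simp: inj_image_eq_iff)

lemma initial_part_map: "inj f \<Longrightarrow> initial_part (map f xs) (f ` A) \<longleftrightarrow> initial_part xs A"
  unfolding initial_part_def by (simp only: take_map image_set_eq)
lemma final_part_map: "inj f \<Longrightarrow> final_part (map f xs) (f ` A) \<longleftrightarrow> final_part xs A"
  unfolding final_part_def by (simp only: drop_map image_set_eq)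
lemma middle_part_map: "inj f \<Longrightarrow> middle_part (map f xs) (f ` A) \<longleftrightarrow> middle_part xs A"
  unfolding middle_part_def by (simp only: take_map drop_map image_set_eq)

lemma Un_eq_split:
  assumes "P \<union> Q = P' \<union> Q'" "P \<subseteq> U" "P' \<subseteq> U" "Q \<subseteq> V" "Q' \<subseteq> V" "U \<inter> V = {}"
  shows "P = P' \<and> Q = Q'"
  using assms by blast

lemma initial_part_append:
  assumes "initial_part (us @ vs) (P \<union> Q)" "P \<subseteq> set us" "Q \<subseteq> set vs" "set us \<inter> set vs = {}"
  shows "initial_part us P \<and> Q = {} \<or> P = set us \<and> initial_part vs Q"
proof -
  obtain n where "P \<union> Q = set (take n us) \<union> set (take (n - length us) vs)"
    using assms(1) by (auto simp: initial_part_def)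
  from Un_eq_split[OF this assms(2) set_take_subset assms(3) set_take_subset assms(4)]
  have "P = set (take n us)" "Q = set (take (n - length us) vs)" by auto
  then show ?thesis unfolding initial_part_def by (cases "n \<le> length us") auto
qed

lemma final_part_append:
  assumes "final_part (us @ vs) (P \<union> Q)" "P \<subseteq> set us" "Q \<subseteq> set vs" "set us \<inter> set vs = {}"
  shows "P = {} \<and> final_part vs Q \<or> final_part us P \<and> Q = set vs"
proof -
  obtain n where "P \<union> Q = set (drop n us) \<union> set (drop (n - length us) vs)"
    using assms(1) by (auto simp: final_part_def)
  from Un_eq_split[OF this assms(2) set_drop_subset assms(3) set_drop_subset assms(4)]
  have "P = set (drop n us)" "Q = set (drop (n - length us) vs)" by auto
  then show ?thesis unfolding final_part_def by (cases "n \<le> length us") auto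
qed

text \<open>A two-sided problem stays two-sided while it lies within one child. Once it straddles a
  boundary between children it falls apart into two one-sided problems.\<close>

lemma middle_part_append:
  assumes "middle_part (us @ vs) (P \<union> Q)" "P \<subseteq> set us" "Q \<subseteq> set vs" "set us \<inter> set vs = {}"
  shows "P = {} \<and> middle_part vs Q \<or> middle_part us P \<and> Q = {} \<or> final_part us P \<and> initial_part vs Q"
proof -
  obtain i n where "P \<union> Q = set (take n (drop i us)) \<union>
      set (take (n - length (drop i us)) (drop (i - length us) vs))"
    using assms(1) by (auto simp: middle_part_def)
  from Un_eq_split[OF this assms(2) _ assms(3) _ assms(4)]
  have PQ: "P = set (take n (drop i us))"
    "Q = set (take (n - length (drop i us)) (drop (i - length us) vs))"
    by (auto dest: in_set_takeD in_set_dropD)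
  consider "i \<ge> length us" | "n \<le> length (drop i us)" | "i < length us" "n > length (drop i us)" by linarith
  then show ?thesis
  proof cases
    case 1 then show ?thesis using PQ unfolding middle_part_def by auto
  next
    case 2 then show ?thesis using PQ unfolding middle_part_def by auto
  next
    case 3 then show ?thesis using PQ unfolding final_part_def initial_part_def by auto
  qed
qed

section \<open>Positions, disjointness and left-to-right order\<close>

fun pos_before :: "pos \<Rightarrow> pos \<Rightarrow> bool" where
  "pos_before (i # p) (j # q) \<longleftrightarrow> i < j \<or> i = j \<and> pos_before p q"
| "pos_before _ _ \<longleftrightarrow> False"

text \<open>The order is decided at the first difference, and no position comes before its own
  extension. A sequence sorted by \<open>pos_before\<close> is therefore disjoint as well as
  ordered.\<close>

lemma pos_before_incomparable: "pos_before p q \<Longrightarrow> \<not> prefix p q \<and> \<not> prefix q p"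
  by (induction p q rule: pos_before.induct) auto

lemma Nil_in_nodes [simp]: "[] \<in> nodes T"
  by (cases T) auto

text \<open>Two prefixes of one position are comparable; conversely, the lower of two comparable
  nodes is a common descendant. The relation is symmetric, so testing the pairs with increasing
  indices is enough, and being irreflexive it also excludes repeated positions.\<close>

lemma disjoint_subtrees_iff:
  "disjoint_subtrees T S \<longleftrightarrow> set S \<subseteq> nodes T \<and> sorted_wrt (\<lambda>p q. \<not> prefix p q \<and> \<not> prefix q p) S"
proof -
  have *: "descendants T p \<inter> descendants T q = {} \<longleftrightarrow> \<not> prefix p q \<and> \<not> prefix q p"
    if "p \<in> nodes T" "q \<in> nodes T" for p q
    using that prefix_same_cases[of p _ q] by (auto simp: descendants_def)
  show ?thesis
  proof (cases "set S \<subseteq> nodes T")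
    case True
    then have "disjoint_subtrees T S \<longleftrightarrow> (\<forall>i < length S. \<forall>j < length S. i \<noteq> j \<longrightarrow>
        \<not> prefix (S ! i) (S ! j) \<and> \<not> prefix (S ! j) (S ! i))"
      unfolding disjoint_subtrees_def using * by (auto simp: subset_iff)
    also have "\<dots> \<longleftrightarrow> sorted_wrt (\<lambda>p q. \<not> prefix p q \<and> \<not> prefix q p) S"
    proof
      assume R: "sorted_wrt (\<lambda>p q. \<not> prefix p q \<and> \<not> prefix q p) S"
      show "\<forall>i < length S. \<forall>j < length S. i \<noteq> j \<longrightarrow> \<not> prefix (S ! i) (S ! j) \<and> \<not> prefix (S ! j) (S ! i)"
      proof (intro allI impI)
        fix i j assume "i < length S" "j < length S" "i \<noteq> j"
        then show "\<not> prefix (S ! i) (S ! j) \<and> \<not> prefix (S ! j) (S ! i)"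
          using sorted_wrt_nth_less[OF R, of i j] sorted_wrt_nth_less[OF R, of j i] by linarith
      qed
    qed (simp add: sorted_wrt_iff_nth_less)
    finally show ?thesis using True by simp
  qed (auto simp: disjoint_subtrees_def)
qed

lemma leaves_below_Nil [simp]: "leaves_below T [] = set (leaves T)"
  by (auto simp: leaves_below_def)

lemma leaves_below_Node2 [simp]:
  "leaves_below (Node2 l r) (0 # p) = (#) 0 ` leaves_below l p"
  "leaves_below (Node2 l r) (Suc 0 # p) = (#) (Suc 0) ` leaves_below r p"
  by (auto simp: leaves_below_def)

lemma leaves_below_Node3 [simp]:
  "leaves_below (Node3 l m r) (0 # p) = (#) 0 ` leaves_below l p"
  "leaves_below (Node3 l m r) (Suc 0 # p) = (#) (Suc 0) ` leaves_below m p"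
  "leaves_below (Node3 l m r) (2 # p) = (#) 2 ` leaves_below r p"
  by (auto simp: leaves_below_def)

lemma leaves_below_nonempty: "p \<in> nodes T \<Longrightarrow> leaves_below T p \<noteq> {}"
  by (induction T arbitrary: p) auto

text \<open>The relation \<open>leaf_before\<close> for an arbitrary list, so that it can be
  followed through \<open>@\<close> and \<open>map\<close> in the equations of
  \<open>leaves\<close>.\<close>

definition before :: "'b list \<Rightarrow> 'b \<Rightarrow> 'b \<Rightarrow> bool" where
  "before xs u v \<longleftrightarrow> (\<exists>i j. i < j \<and> j < length xs \<and> xs ! i = u \<and> xs ! j = v)"

lemma before_append:
  assumes "before (xs @ ys) u v"
  shows "before xs u v \<or> before ys u v \<or> u \<in> set xs \<and> v \<in> set ys"
proof -
  obtain i j where ij: "i < j" "j < length xs + length ys" "(xs @ ys) ! i = u" "(xs @ ys) ! j = v"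
    using assms by (auto simp: before_def)
  consider "j < length xs" | "length xs \<le> i" | "i < length xs" "length xs \<le> j" by linarith
  then show ?thesis
  proof cases
    case 1 then show ?thesis using ij unfolding before_def by (auto simp: nth_append)
  next
    case 2
    then have "i - length xs < j - length xs" "j - length xs < length ys"
      "ys ! (i - length xs) = u" "ys ! (j - length xs) = v" using ij by (auto simp: nth_append)
    then show ?thesis unfolding before_def by blast
  next
    case 3 then show ?thesis using ij by (auto simp: nth_append)
  qed
qed

lemma before_map: "before (map f xs) u v \<Longrightarrow> \<exists>a b. u = f a \<and> v = f b \<and> before xs a b"
  unfolding before_def by auto (metis order_less_trans)

lemma before_leaves_pos_before: "before (leaves T) u v \<Longrightarrow> pos_before u v"
proof (induction T arbitrary: u v)
  case (Leaf x) then show ?case by (auto simp: before_def)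
next
  case (Node2 l r)
  then show ?case by (auto dest!: before_append before_map)
next
  case (Node3 l m r)
  then show ?case by (auto dest!: before_append before_map)
qed

lemma pos_before_prefix: "pos_before u v \<Longrightarrow> prefix p u \<Longrightarrow> prefix q v \<Longrightarrow> \<not> prefix p q \<Longrightarrow> \<not> prefix q p \<Longrightarrow> pos_before p q"
proof (induction u v arbitrary: p q rule: pos_before.induct)
  case (1 i u j v)
  then show ?case by (cases p; cases q) auto
qed auto

text \<open>One leaf below each node decides the order, since incomparable positions differ at a
  place that all their extensions share. That such leaves exist matters, because
  \<open>left_of\<close> quantifies over leaves and would otherwise hold vacuously.\<close>

lemma left_of_pos_before:
  assumes "left_of T p q" "p \<in> nodes T" "q \<in> nodes T" "\<not> prefix p q" "\<not> prefix q p"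
  shows "pos_before p q"
proof -
  obtain u v where "u \<in> leaves_below T p" "v \<in> leaves_below T q"
    using leaves_below_nonempty assms by blast
  then show ?thesis using assms before_leaves_pos_before[of T u v] pos_before_prefix[of u v p q]
    by (auto simp: left_of_def leaf_before_def before_def leaves_below_def)
qed

text \<open>Without the condition on consecutive leaves, minimality passes to the sublists of
  \<open>S\<close> below each child of the root.\<close>

definition minimal :: "'a tree23 \<Rightarrow> pos list \<Rightarrow> bool" where
  "minimal T S \<longleftrightarrow> set S \<subseteq> nodes T \<and> sorted_wrt pos_before S \<and>
    (\<forall>S'. disjoint_subtrees T S' \<and> leaves_of T S' = leaves_of T S \<longrightarrow> length S \<le> length S')"

lemma ordered_slice_minimal:
  assumes "is_ordered_slice T S"
  shows "minimal T S"
proof -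
  have n: "set S \<subseteq> nodes T" and d: "sorted_wrt (\<lambda>p q. \<not> prefix p q \<and> \<not> prefix q p) S"
    and l: "sorted_wrt (left_of T) S"
    using assms by (auto simp: is_ordered_slice_def is_slice_def disjoint_subtrees_iff)
  have "sorted_wrt pos_before S"
    using d l n left_of_pos_before[of T] unfolding sorted_wrt_iff_nth_less
    by (meson nth_mem order_less_trans subsetD)
  then show ?thesis using assms n by (auto simp: minimal_def is_ordered_slice_def is_slice_def)
qed

lemma sorted_pos_before_incomparable: "sorted_wrt pos_before S \<Longrightarrow> sorted_wrt (\<lambda>p q. \<not> prefix p q \<and> \<not> prefix q p) S"
  by (rule sorted_wrt_mono_rel[of _ pos_before]) (auto dest: pos_before_incomparable)

lemma leaves_of_append [simp]: "leaves_of T (A @ B) = leaves_of T A \<union> leaves_of T B"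
  by (auto simp: leaves_of_def)

lemma leaves_of_Nil [simp]: "leaves_of T [] = {}"
  by (auto simp: leaves_of_def)

lemma leaves_of_root: "leaves_of T [[]] = set (leaves T)"
  by (auto simp: leaves_of_def)

lemma leaves_of_Cons [simp]: "leaves_of T (p # S) = leaves_below T p \<union> leaves_of T S"
  by (auto simp: leaves_of_def)

lemma leaves_of_map [simp]:
  "leaves_of (Node2 l r) (map ((#) 0) A) = (#) 0 ` leaves_of l A"
  "leaves_of (Node2 l r) (map ((#) (Suc 0)) A) = (#) (Suc 0) ` leaves_of r A"
  "leaves_of (Node3 l m r) (map ((#) 0) A) = (#) 0 ` leaves_of l A"
  "leaves_of (Node3 l m r) (map ((#) (Suc 0)) A) = (#) (Suc 0) ` leaves_of m A"
  "leaves_of (Node3 l m r) (map ((#) 2) A) = (#) 2 ` leaves_of r A"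
  by (auto simp: leaves_of_def)

lemma leaves_of_subset: "leaves_of T S \<subseteq> set (leaves T)"
  by (auto simp: leaves_of_def leaves_below_def)

text \<open>The empty sequence is a competitor with the same set of leaves.\<close>

lemma minimal_empty: "minimal T S \<Longrightarrow> leaves_of T S = {} \<Longrightarrow> S = []"
  unfolding minimal_def by (auto simp: disjoint_subtrees_iff dest!: spec[of _ "[]"])

section \<open>Restricting minimal sequences to the children of the root\<close>

definition child_part :: "nat \<Rightarrow> pos list \<Rightarrow> pos list" where
  "child_part j S = map tl (filter (\<lambda>p. hd p = j) S)"

lemma child_part_Cons: "child_part j (p # S) = (if hd p = j then tl p # child_part j S else child_part j S)"
  by (simp add: child_part_def)

text \<open>Sorting by \<open>pos_before\<close> makes the first indices weakly increase, so the
  positions below each child form one contiguous block.\<close>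

lemma child_parts:
  "sorted_wrt pos_before S \<Longrightarrow> \<forall>p \<in> set S. p \<noteq> [] \<and> hd p < 3 \<Longrightarrow>
    S = map ((#) 0) (child_part 0 S) @ map ((#) (Suc 0)) (child_part (Suc 0) S) @ map ((#) 2) (child_part 2 S)"
proof (induction S)
  case (Cons p S)
  then obtain j q where p: "p = j # q" "j < 3" by (cases p) auto
  have ge: "j \<le> hd x" if "x \<in> set S" for x
    using Cons.prems that p by (cases x; force)
  have emp: "child_part i S = []" if "i < j" for i
    using ge that by (force simp: child_part_def filter_empty_conv)
  have IH: "S = map ((#) 0) (child_part 0 S) @ map ((#) (Suc 0)) (child_part (Suc 0) S) @ map ((#) 2) (child_part 2 S)"
    using Cons by auto
  consider "j = 0" | "j = Suc 0" | "j = 2" using p by linarith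
  then show ?case
  proof cases
    case 1 then show ?thesis using p by (simp add: child_part_Cons IH[symmetric])
  next
    case 2
    then have e: "child_part 0 S = []" using emp by simp
    show ?thesis using p 2 by (simp add: child_part_Cons e IH[unfolded e list.map append_Nil, symmetric])
  next
    case 3
    then have e: "child_part 0 S = []" "child_part (Suc 0) S = []" using emp by simp_all
    show ?thesis using p 3 by (simp add: child_part_Cons e IH[unfolded e list.map append_Nil, symmetric])
  qed
qed (auto simp: child_part_def)

text \<open>The root is a prefix of every position, hence neither before nor after any other, and in
  a sorted sequence it must stand alone.\<close>

lemma minimal_cases:
  assumes "minimal T S"
  shows "S = [[]] \<or> (\<forall>p \<in> set S. p \<noteq> [])"
proof (cases "[] \<in> set S")
  case True
  then obtain A B where S: "S = A @ [] # B" by (auto simp: in_set_conv_decomp)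
  have "sorted_wrt pos_before S" using assms by (auto simp: minimal_def)
  then have "A = []" "B = []" unfolding S by (cases A; cases B; auto simp: sorted_wrt_append)+
  then show ?thesis using S by simp
qed auto

lemma minimal_Leaf: "minimal (Leaf x) S \<Longrightarrow> S = [] \<or> S = [[]]"
  using minimal_cases[of "Leaf x" S] by (cases S) (auto simp: minimal_def)

text \<open>An exchange argument: a shorter disjoint sequence below one child with the same leaves
  could replace the block of that child and would shorten the whole. The competitors in
  \<open>minimal\<close> need not be sorted, so the exchange has only disjointness to
  preserve.\<close>

lemma minimal_Node2:
  assumes "minimal (Node2 l r) S" "S \<noteq> [[]]"
  obtains S0 S1 where "S = map ((#) 0) S0 @ map ((#) (Suc 0)) S1" "minimal l S0" "minimal r S1"
proof -
  let ?T = "Node2 l r"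
  have ne: "\<forall>p \<in> set S. p \<noteq> []" using minimal_cases[OF assms(1)] assms(2) by auto
  have n: "set S \<subseteq> nodes ?T" "sorted_wrt pos_before S" using assms(1) by (auto simp: minimal_def)
  have hd: "p \<noteq> [] \<and> hd p < 2" if "p \<in> set S" for p using ne subsetD[OF n(1) that] that by auto
  then have "child_part 2 S = []" by (force simp: child_part_def filter_empty_conv)
  moreover have "\<forall>p \<in> set S. p \<noteq> [] \<and> hd p < 3" using hd by force
  ultimately have eq: "S = map ((#) 0) (child_part 0 S) @ map ((#) (Suc 0)) (child_part (Suc 0) S)"
    using child_parts[OF n(2)] by (metis append_Nil2 list.map(1))
  obtain S0 S1 where S: "S = map ((#) 0) S0 @ map ((#) (Suc 0)) S1" by (rule that[OF eq])
  have n0: "set S0 \<subseteq> nodes l" "set S1 \<subseteq> nodes r" "sorted_wrt pos_before S0" "sorted_wrt pos_before S1"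
    using n unfolding S by (auto simp: sorted_wrt_append sorted_wrt_map)
  have min: "length S \<le> length S'" if "disjoint_subtrees ?T S'" "leaves_of ?T S' = leaves_of ?T S" for S'
    using that assms(1) by (auto simp: minimal_def)
  have "minimal l S0" unfolding minimal_def
  proof (intro conjI allI impI)
    fix A assume A: "disjoint_subtrees l A \<and> leaves_of l A = leaves_of l S0"
    have "disjoint_subtrees ?T (map ((#) 0) A @ map ((#) (Suc 0)) S1)"
      using A n0 by (auto simp: disjoint_subtrees_iff sorted_wrt_append sorted_wrt_map sorted_pos_before_incomparable)
    from min[OF this] show "length S0 \<le> length A" using A S by simp
  qed (use n0 in auto)
  moreover have "minimal r S1" unfolding minimal_def
  proof (intro conjI allI impI)
    fix A assume A: "disjoint_subtrees r A \<and> leaves_of r A = leaves_of r S1"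
    have "disjoint_subtrees ?T (map ((#) 0) S0 @ map ((#) (Suc 0)) A)"
      using A n0 by (auto simp: disjoint_subtrees_iff sorted_wrt_append sorted_wrt_map sorted_pos_before_incomparable)
    from min[OF this] show "length S1 \<le> length A" using A S by simp
  qed (use n0 in auto)
  ultimately show ?thesis using that S by blast
qed

lemma minimal_Node3:
  assumes "minimal (Node3 l m r) S" "S \<noteq> [[]]"
  obtains S0 S1 S2 where "S = map ((#) 0) S0 @ map ((#) (Suc 0)) S1 @ map ((#) 2) S2"
    "minimal l S0" "minimal m S1" "minimal r S2"
proof -
  let ?T = "Node3 l m r"
  have ne: "\<forall>p \<in> set S. p \<noteq> []" using minimal_cases[OF assms(1)] assms(2) by auto
  have n: "set S \<subseteq> nodes ?T" "sorted_wrt pos_before S" using assms(1) by (auto simp: minimal_def)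
  have "p \<noteq> [] \<and> hd p < 3" if "p \<in> set S" for p using ne subsetD[OF n(1) that] that by auto
  then have hd: "\<forall>p \<in> set S. p \<noteq> [] \<and> hd p < 3" by blast
  obtain S0 S1 S2 where S: "S = map ((#) 0) S0 @ map ((#) (Suc 0)) S1 @ map ((#) 2) S2"
    by (rule that[OF child_parts[OF n(2) hd]])
  have n0: "set S0 \<subseteq> nodes l" "set S1 \<subseteq> nodes m" "set S2 \<subseteq> nodes r"
    "sorted_wrt pos_before S0" "sorted_wrt pos_before S1" "sorted_wrt pos_before S2"
    using n unfolding S by (auto simp: sorted_wrt_append sorted_wrt_map)
  have min: "length S \<le> length S'" if "disjoint_subtrees ?T S'" "leaves_of ?T S' = leaves_of ?T S" for S'
    using that assms(1) by (auto simp: minimal_def)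
  have "minimal l S0" unfolding minimal_def
  proof (intro conjI allI impI)
    fix A assume A: "disjoint_subtrees l A \<and> leaves_of l A = leaves_of l S0"
    have "disjoint_subtrees ?T (map ((#) 0) A @ map ((#) (Suc 0)) S1 @ map ((#) 2) S2)"
      using A n0 by (auto simp: disjoint_subtrees_iff sorted_wrt_append sorted_wrt_map sorted_pos_before_incomparable)
    from min[OF this] show "length S0 \<le> length A" using A S by simp
  qed (use n0 in auto)
  moreover have "minimal m S1" unfolding minimal_def
  proof (intro conjI allI impI)
    fix A assume A: "disjoint_subtrees m A \<and> leaves_of m A = leaves_of m S1"
    have "disjoint_subtrees ?T (map ((#) 0) S0 @ map ((#) (Suc 0)) A @ map ((#) 2) S2)"
      using A n0 by (auto simp: disjoint_subtrees_iff sorted_wrt_append sorted_wrt_map sorted_pos_before_incomparable)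
    from min[OF this] show "length S1 \<le> length A" using A S by simp
  qed (use n0 in auto)
  moreover have "minimal r S2" unfolding minimal_def
  proof (intro conjI allI impI)
    fix A assume A: "disjoint_subtrees r A \<and> leaves_of r A = leaves_of r S2"
    have "disjoint_subtrees ?T (map ((#) 0) S0 @ map ((#) (Suc 0)) S1 @ map ((#) 2) A)"
      using A n0 by (auto simp: disjoint_subtrees_iff sorted_wrt_append sorted_wrt_map sorted_pos_before_incomparable)
    from min[OF this] show "length S2 \<le> length A" using A S by simp
  qed (use n0 in auto)
  ultimately show ?thesis using that S by blast
qed

text \<open>The root alone is a competitor, so \<open>S\<close> has a single position. It is the
  root itself: below a proper descendant all leaf positions share their first index, whereas an
  internal root has leaves below both its first and its second child.\<close>

lemma minimal_all:
  assumes "minimal T S" "leaves_of T S = set (leaves T)"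
  shows "S = [[]]"
proof -
  have "disjoint_subtrees T [[]]" by (simp add: disjoint_subtrees_iff)
  moreover have "leaves_of T [[]] = leaves_of T S" using assms(2) leaves_of_root by simp
  ultimately have "length S \<le> length [[] :: pos]"
    using assms(1) unfolding minimal_def by blast
  moreover have "S \<noteq> []" using assms(2) by auto
  ultimately obtain p where S: "S = [p]" by (cases S) auto
  then have p: "leaves_below T p = set (leaves T)" "p \<in> nodes T"
    using assms by (auto simp: leaves_of_def minimal_def)
  have "p = []"
  proof (rule ccontr)
    assume "p \<noteq> []"
    then obtain j q where jq: "p = j # q" by (cases p) auto
    have first: "hd u = j" if "u \<in> set (leaves T)" for u
      using that unfolding p(1)[symmetric] jq by (auto simp: leaves_below_def prefix_def)
    show False
    proof (cases T)
      case (Node2 l r)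
      then show False
        using first[of "0 # hd (leaves l)"] first[of "1 # hd (leaves r)"] by simp
    next
      case (Node3 l m r)
      then show False
        using first[of "0 # hd (leaves l)"] first[of "1 # hd (leaves m)"] by simp
    qed (use p(2) jq in simp)
  qed
  then show ?thesis using S by simp
qed

section \<open>The shape of the sequence of heights\<close>

definition heights :: "'a tree23 \<Rightarrow> pos list \<Rightarrow> nat list" where
  "heights T S = map (\<lambda>p. height (subtree T p)) S"

lemma heights_simps [simp]:
  "heights T [] = []" "heights T (p # A) = height (subtree T p) # heights T A" "heights T (A @ B) = heights T A @ heights T B"
  "heights (Node2 l r) (map ((#) 0) A) = heights l A"
  "heights (Node2 l r) (map ((#) (Suc 0)) A) = heights r A"
  "heights (Node3 l m r) (map ((#) 0) A) = heights l A"
  "heights (Node3 l m r) (map ((#) (Suc 0)) A) = heights m A"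
  "heights (Node3 l m r) (map ((#) 2) A) = heights r A"
  by (auto simp: heights_def)


lemma inj_Cons [simp]: "inj ((#) x)"
  by (simp add: inj_def)

lemma image_Cons_eq [simp]: "(#) x ` A = (#) x ` B \<longleftrightarrow> A = B"
  by (simp add: inj_image_eq_iff)

lemma Cons_disjoint:
  "set (map ((#) 0) xs) \<inter> set (map ((#) (Suc 0)) ys) = {}"
  "set (map ((#) (Suc 0)) xs) \<inter> set (map ((#) 2) ys) = {}"
  "set (map ((#) 0) xs) \<inter> set (map ((#) (Suc 0)) ys @ map ((#) 2) zs) = {}"
  by auto

lemma final_part_Node2:
  assumes "final_part (leaves (Node2 l r)) ((#) 0 ` A \<union> (#) (Suc 0) ` B)" "A \<subseteq> set (leaves l)" "B \<subseteq> set (leaves r)"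
  shows "A = {} \<and> final_part (leaves r) B \<or> final_part (leaves l) A \<and> B = set (leaves r)"
  using final_part_append[OF assms(1)[simplified] _ _ Cons_disjoint(1)] assms(2,3)
  by (simp add: final_part_map image_mono)

lemma initial_part_Node2:
  assumes "initial_part (leaves (Node2 l r)) ((#) 0 ` A \<union> (#) (Suc 0) ` B)" "A \<subseteq> set (leaves l)" "B \<subseteq> set (leaves r)"
  shows "initial_part (leaves l) A \<and> B = {} \<or> A = set (leaves l) \<and> initial_part (leaves r) B"
  using initial_part_append[OF assms(1)[simplified] _ _ Cons_disjoint(1)] assms(2,3)
  by (simp add: initial_part_map image_mono)

lemma middle_part_Node2:
  assumes "middle_part (leaves (Node2 l r)) ((#) 0 ` A \<union> (#) (Suc 0) ` B)" "A \<subseteq> set (leaves l)" "B \<subseteq> set (leaves r)"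
  shows "A = {} \<and> middle_part (leaves r) B \<or> middle_part (leaves l) A \<and> B = {} \<or> final_part (leaves l) A \<and> initial_part (leaves r) B"
  using middle_part_append[OF assms(1)[simplified] _ _ Cons_disjoint(1)] assms(2,3)
  by (simp add: middle_part_map final_part_map initial_part_map image_mono)

lemma final_part_Node3:
  assumes "final_part (leaves (Node3 l m r)) ((#) 0 ` A \<union> ((#) (Suc 0) ` B \<union> (#) 2 ` C))"
    "A \<subseteq> set (leaves l)" "B \<subseteq> set (leaves m)" "C \<subseteq> set (leaves r)"
  shows "A = {} \<and> B = {} \<and> final_part (leaves r) C \<or> A = {} \<and> final_part (leaves m) B \<and> C = set (leaves r) \<or>
    final_part (leaves l) A \<and> B = set (leaves m) \<and> C = set (leaves r)"
proof -
  let ?v = "map ((#) (Suc 0)) (leaves m) @ map ((#) 2) (leaves r)"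
  have "(#) 0 ` A = {} \<and> final_part ?v ((#) (Suc 0) ` B \<union> (#) 2 ` C) \<or>
    final_part (map ((#) 0) (leaves l)) ((#) 0 ` A) \<and> (#) (Suc 0) ` B \<union> (#) 2 ` C = set ?v"
    by (rule final_part_append[OF _ _ _ Cons_disjoint(3)]) (use assms in auto)
  then show ?thesis
  proof (elim disjE conjE)
    assume a: "(#) 0 ` A = {}" "final_part ?v ((#) (Suc 0) ` B \<union> (#) 2 ` C)"
    show ?thesis using final_part_append[OF a(2) _ _ Cons_disjoint(2)] a(1) assms(3,4) by (auto simp: final_part_map image_mono)
  next
    assume a: "final_part (map ((#) 0) (leaves l)) ((#) 0 ` A)" "(#) (Suc 0) ` B \<union> (#) 2 ` C = set ?v"
    have "(#) (Suc 0) ` B = (#) (Suc 0) ` set (leaves m) \<and> (#) 2 ` C = (#) 2 ` set (leaves r)"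
      by (rule Un_eq_split[OF _ _ _ _ _ Cons_disjoint(2)[of "leaves m" "leaves r"]])
        (use a(2) assms(3,4) in \<open>simp_all add: image_mono\<close>)
    then have "B = set (leaves m)" "C = set (leaves r)" by simp_all
    then show ?thesis using a(1) by (simp add: final_part_map)
  qed
qed

lemma initial_part_Node3:
  assumes "initial_part (leaves (Node3 l m r)) ((#) 0 ` A \<union> ((#) (Suc 0) ` B \<union> (#) 2 ` C))"
    "A \<subseteq> set (leaves l)" "B \<subseteq> set (leaves m)" "C \<subseteq> set (leaves r)"
  shows "initial_part (leaves l) A \<and> B = {} \<and> C = {} \<or> A = set (leaves l) \<and> initial_part (leaves m) B \<and> C = {} \<or>
    A = set (leaves l) \<and> B = set (leaves m) \<and> initial_part (leaves r) C"
proof -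
  let ?v = "map ((#) (Suc 0)) (leaves m) @ map ((#) 2) (leaves r)"
  have "initial_part (map ((#) 0) (leaves l)) ((#) 0 ` A) \<and> (#) (Suc 0) ` B \<union> (#) 2 ` C = {} \<or>
    (#) 0 ` A = set (map ((#) 0) (leaves l)) \<and> initial_part ?v ((#) (Suc 0) ` B \<union> (#) 2 ` C)"
    by (rule initial_part_append[OF _ _ _ Cons_disjoint(3)]) (use assms in auto)
  then show ?thesis
  proof (elim disjE conjE)
    assume a: "(#) 0 ` A = set (map ((#) 0) (leaves l))" "initial_part ?v ((#) (Suc 0) ` B \<union> (#) 2 ` C)"
    show ?thesis using initial_part_append[OF a(2) _ _ Cons_disjoint(2)] a(1) assms(3,4) by (simp add: initial_part_map image_mono)
  next
    assume a: "initial_part (map ((#) 0) (leaves l)) ((#) 0 ` A)" "(#) (Suc 0) ` B \<union> (#) 2 ` C = {}"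
    then show ?thesis by (simp add: initial_part_map)
  qed
qed

lemma middle_part_Node3:
  assumes "middle_part (leaves (Node3 l m r)) ((#) 0 ` A \<union> ((#) (Suc 0) ` B \<union> (#) 2 ` C))"
    "A \<subseteq> set (leaves l)" "B \<subseteq> set (leaves m)" "C \<subseteq> set (leaves r)"
  shows "middle_part (leaves l) A \<and> B = {} \<and> C = {} \<or> A = {} \<and> middle_part (leaves m) B \<and> C = {} \<or>
    A = {} \<and> B = {} \<and> middle_part (leaves r) C \<or>
    final_part (leaves l) A \<and> initial_part (leaves m) B \<and> C = {} \<or> A = {} \<and> final_part (leaves m) B \<and> initial_part (leaves r) C \<or>
    final_part (leaves l) A \<and> B = set (leaves m) \<and> initial_part (leaves r) C"
proof -
  let ?v = "map ((#) (Suc 0)) (leaves m) @ map ((#) 2) (leaves r)"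
  have "(#) 0 ` A = {} \<and> middle_part ?v ((#) (Suc 0) ` B \<union> (#) 2 ` C) \<or>
    middle_part (map ((#) 0) (leaves l)) ((#) 0 ` A) \<and> (#) (Suc 0) ` B \<union> (#) 2 ` C = {} \<or>
    final_part (map ((#) 0) (leaves l)) ((#) 0 ` A) \<and> initial_part ?v ((#) (Suc 0) ` B \<union> (#) 2 ` C)"
    by (rule middle_part_append[OF _ _ _ Cons_disjoint(3)]) (use assms in auto)
  then show ?thesis
  proof (elim disjE conjE)
    assume a: "(#) 0 ` A = {}" "middle_part ?v ((#) (Suc 0) ` B \<union> (#) 2 ` C)"
    show ?thesis using middle_part_append[OF a(2) _ _ Cons_disjoint(2)] a(1) assms(3,4)
      by (auto simp: middle_part_map final_part_map initial_part_map image_mono)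
  next
    assume a: "final_part (map ((#) 0) (leaves l)) ((#) 0 ` A)" "initial_part ?v ((#) (Suc 0) ` B \<union> (#) 2 ` C)"
    show ?thesis using initial_part_append[OF a(2) _ _ Cons_disjoint(2)] a(1) assms(3,4)
      by (auto simp: final_part_map initial_part_map image_mono)
  next
    assume a: "middle_part (map ((#) 0) (leaves l)) ((#) 0 ` A)" "(#) (Suc 0) ` B \<union> (#) 2 ` C = {}"
    then show ?thesis by (simp add: middle_part_map)
  qed
qed

text \<open>Only one child is covered in part; each child to its right is covered completely and
  contributes one tree of height \<open>g\<close>. The bound in the second conjunct is what lets
  these trees be appended to the staircase from the partly covered child.\<close>

lemma final_part_heights:
  "full h T \<Longrightarrow> minimal T S \<Longrightarrow> final_part (leaves T) (leaves_of T S) \<Longrightarrow>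
    staircase (heights T S) \<and> (S = [[]] \<or> (\<forall>x \<in> set (heights T S). x < h))"
proof (induction T arbitrary: h S)
  case (Leaf x)
  then show ?case using minimal_Leaf[of x S] by auto
next
  case (Node2 l r)
  obtain g where g: "h = Suc g" "full g l" "full g r" using Node2.prems by auto
  note ht = full_height[OF g(2)] full_height[OF g(3)]
  show ?case
  proof (cases "S = [[]]")
    case False
    obtain S0 S1 where S: "S = map ((#) 0) S0 @ map ((#) (Suc 0)) S1" "minimal l S0" "minimal r S1"
      by (rule minimal_Node2[OF Node2.prems(2) False])
    consider "leaves_of l S0 = {}" "final_part (leaves r) (leaves_of r S1)"
      | "final_part (leaves l) (leaves_of l S0)" "leaves_of r S1 = set (leaves r)"
      using final_part_Node2[of l r, OF _ leaves_of_subset[of l S0] leaves_of_subset[of r S1]] Node2.prems(3) S(1) by auto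
    then show ?thesis
    proof cases
      case 1
      then have "S0 = []" using minimal_empty S by blast
      then show ?thesis using Node2.IH(2)[OF g(3) S(3) 1(2)] S(1) g ht by auto
    next
      case 2
      then have "S1 = [[]]" using minimal_all S by blast
      then show ?thesis using Node2.IH(1)[OF g(2) S(2) 2(1)] S(1) g ht staircase_snoc[of "heights l S0" g] by auto
    qed
  qed auto
next
  case (Node3 l m r)
  obtain g where g: "h = Suc g" "full g l" "full g m" "full g r" using Node3.prems by auto
  note ht = full_height[OF g(2)] full_height[OF g(3)] full_height[OF g(4)]
  show ?case
  proof (cases "S = [[]]")
    case False
    obtain S0 S1 S2 where S: "S = map ((#) 0) S0 @ map ((#) (Suc 0)) S1 @ map ((#) 2) S2"
      "minimal l S0" "minimal m S1" "minimal r S2"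
      by (rule minimal_Node3[OF Node3.prems(2) False])
    \<comment> \<open>This excludes three trees of height \<open>g\<close>: if all children were
      covered, minimality would have left the root alone.\<close>
    have not_all: "leaves_of (Node3 l m r) S \<noteq> set (leaves (Node3 l m r))"
      using minimal_all[OF Node3.prems(2)] False by blast
    consider "leaves_of l S0 = {}" "leaves_of m S1 = {}" "final_part (leaves r) (leaves_of r S2)"
      | "leaves_of l S0 = {}" "final_part (leaves m) (leaves_of m S1)" "leaves_of r S2 = set (leaves r)"
      | "final_part (leaves l) (leaves_of l S0)" "leaves_of m S1 = set (leaves m)" "leaves_of r S2 = set (leaves r)"
      using final_part_Node3[of l m r, OF _ leaves_of_subset[of l S0] leaves_of_subset[of m S1] leaves_of_subset[of r S2]]
        Node3.prems(3) S(1) by auto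
    then show ?thesis
    proof cases
      case 1
      then have "S0 = []" "S1 = []" using minimal_empty S by blast+
      then show ?thesis using Node3.IH(3)[OF g(4) S(4) 1(3)] S(1) g ht by auto
    next
      case 2
      then have "S0 = []" "S2 = [[]]" using minimal_empty minimal_all S by blast+
      then show ?thesis using Node3.IH(2)[OF g(3) S(3) 2(2)] S(1) g ht staircase_snoc[of "heights m S1" g] by auto
    next
      case 3
      then have s: "S1 = [[]]" "S2 = [[]]" using minimal_all S by blast+
      then have "S0 \<noteq> [[]]" using not_all S(1) by auto
      then show ?thesis using s Node3.IH(1)[OF g(2) S(2) 3(1)] S(1) g ht staircase_snoc_snoc[of "heights l S0" g] by auto
    qed
  qed auto
qed

text \<open>The mirror image of \<open>final_part_heights\<close>: the completely covered children
  now come first, so the staircase is read from the right.\<close>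

lemma initial_part_heights:
  "full h T \<Longrightarrow> minimal T S \<Longrightarrow> initial_part (leaves T) (leaves_of T S) \<Longrightarrow>
    staircase (rev (heights T S)) \<and> (S = [[]] \<or> (\<forall>x \<in> set (heights T S). x < h))"
proof (induction T arbitrary: h S)
  case (Leaf x)
  then show ?case using minimal_Leaf[of x S] by auto
next
  case (Node2 l r)
  obtain g where g: "h = Suc g" "full g l" "full g r" using Node2.prems by auto
  note ht = full_height[OF g(2)] full_height[OF g(3)]
  show ?case
  proof (cases "S = [[]]")
    case False
    obtain S0 S1 where S: "S = map ((#) 0) S0 @ map ((#) (Suc 0)) S1" "minimal l S0" "minimal r S1"
      by (rule minimal_Node2[OF Node2.prems(2) False])
    consider "initial_part (leaves l) (leaves_of l S0)" "leaves_of r S1 = {}"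
      | "leaves_of l S0 = set (leaves l)" "initial_part (leaves r) (leaves_of r S1)"
      using initial_part_Node2[of l r, OF _ leaves_of_subset[of l S0] leaves_of_subset[of r S1]] Node2.prems(3) S(1) by auto
    then show ?thesis
    proof cases
      case 1
      then have "S1 = []" using minimal_empty S by blast
      then show ?thesis using Node2.IH(1)[OF g(2) S(2) 1(1)] S(1) g ht by auto
    next
      case 2
      then have "S0 = [[]]" using minimal_all S by blast
      then show ?thesis using Node2.IH(2)[OF g(3) S(3) 2(2)] S(1) g ht staircase_snoc[of "rev (heights r S1)" g] by auto
    qed
  qed auto
next
  case (Node3 l m r)
  obtain g where g: "h = Suc g" "full g l" "full g m" "full g r" using Node3.prems by auto
  note ht = full_height[OF g(2)] full_height[OF g(3)] full_height[OF g(4)]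
  show ?case
  proof (cases "S = [[]]")
    case False
    obtain S0 S1 S2 where S: "S = map ((#) 0) S0 @ map ((#) (Suc 0)) S1 @ map ((#) 2) S2"
      "minimal l S0" "minimal m S1" "minimal r S2"
      by (rule minimal_Node3[OF Node3.prems(2) False])
    have not_all: "leaves_of (Node3 l m r) S \<noteq> set (leaves (Node3 l m r))"
      using minimal_all[OF Node3.prems(2)] False by blast
    consider "initial_part (leaves l) (leaves_of l S0)" "leaves_of m S1 = {}" "leaves_of r S2 = {}"
      | "leaves_of l S0 = set (leaves l)" "initial_part (leaves m) (leaves_of m S1)" "leaves_of r S2 = {}"
      | "leaves_of l S0 = set (leaves l)" "leaves_of m S1 = set (leaves m)" "initial_part (leaves r) (leaves_of r S2)"
      using initial_part_Node3[of l m r, OF _ leaves_of_subset[of l S0] leaves_of_subset[of m S1] leaves_of_subset[of r S2]]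
        Node3.prems(3) S(1) by auto
    then show ?thesis
    proof cases
      case 1
      then have "S1 = []" "S2 = []" using minimal_empty S by blast+
      then show ?thesis using Node3.IH(1)[OF g(2) S(2) 1(1)] S(1) g ht by auto
    next
      case 2
      then have "S0 = [[]]" "S2 = []" using minimal_empty minimal_all S by blast+
      then show ?thesis using Node3.IH(2)[OF g(3) S(3) 2(2)] S(1) g ht staircase_snoc[of "rev (heights m S1)" g] by auto
    next
      case 3
      then have s: "S0 = [[]]" "S1 = [[]]" using minimal_all S by blast+
      then have "S2 \<noteq> [[]]" using not_all S(1) by auto
      then show ?thesis using s Node3.IH(3)[OF g(4) S(4) 3(3)] S(1) g ht staircase_snoc_snoc[of "rev (heights r S2)" g] by auto
    qed
  qed auto
qed

lemma middle_part_heights: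
  "full h T \<Longrightarrow> minimal T S \<Longrightarrow> middle_part (leaves T) (leaves_of T S) \<Longrightarrow>
    \<exists>us vs. heights T S = us @ vs \<and> staircase us \<and> staircase (rev vs)"
proof (induction T arbitrary: h S)
  case (Leaf x)
  then have "staircase (heights (Leaf x) S)" using minimal_Leaf[of x S] by auto
  then show ?case by - (rule exI[of _ "heights (Leaf x) S"], rule exI[of _ "[]"], simp)
next
  case (Node2 l r)
  obtain g where g: "h = Suc g" "full g l" "full g r" using Node2.prems by auto
  show ?case
  proof (cases "S = [[]]")
    case True
    then show ?thesis by - (rule exI[of _ "heights (Node2 l r) S"], rule exI[of _ "[]"], auto)
  next
    case False
    obtain S0 S1 where S: "S = map ((#) 0) S0 @ map ((#) (Suc 0)) S1" "minimal l S0" "minimal r S1"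
      by (rule minimal_Node2[OF Node2.prems(2) False])
    consider "leaves_of l S0 = {}" "middle_part (leaves r) (leaves_of r S1)"
      | "middle_part (leaves l) (leaves_of l S0)" "leaves_of r S1 = {}"
      | "final_part (leaves l) (leaves_of l S0)" "initial_part (leaves r) (leaves_of r S1)"
      using middle_part_Node2[of l r, OF _ leaves_of_subset[of l S0] leaves_of_subset[of r S1]] Node2.prems(3) S(1) by auto
    then show ?thesis
    proof cases
      case 1
      then have "S0 = []" using minimal_empty S by blast
      then show ?thesis using Node2.IH(2)[OF g(3) S(3) 1(2)] S(1) by auto
    next
      case 2
      then have "S1 = []" using minimal_empty S by blast
      then show ?thesis using Node2.IH(1)[OF g(2) S(2) 2(1)] S(1) by auto
    next
      case 3
      then show ?thesis using final_part_heights[OF g(2) S(2) 3(1)] initial_part_heights[OF g(3) S(3) 3(2)] S(1)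
        by - (rule exI[of _ "heights l S0"], rule exI[of _ "heights r S1"], simp)
    qed
  qed
next
  case (Node3 l m r)
  obtain g where g: "h = Suc g" "full g l" "full g m" "full g r" using Node3.prems by auto
  show ?case
  proof (cases "S = [[]]")
    case True
    then show ?thesis by - (rule exI[of _ "heights (Node3 l m r) S"], rule exI[of _ "[]"], auto)
  next
    case False
    obtain S0 S1 S2 where S: "S = map ((#) 0) S0 @ map ((#) (Suc 0)) S1 @ map ((#) 2) S2"
      "minimal l S0" "minimal m S1" "minimal r S2"
      by (rule minimal_Node3[OF Node3.prems(2) False])
    consider "middle_part (leaves l) (leaves_of l S0)" "leaves_of m S1 = {}" "leaves_of r S2 = {}"
      | "leaves_of l S0 = {}" "middle_part (leaves m) (leaves_of m S1)" "leaves_of r S2 = {}"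
      | "leaves_of l S0 = {}" "leaves_of m S1 = {}" "middle_part (leaves r) (leaves_of r S2)"
      | "final_part (leaves l) (leaves_of l S0)" "initial_part (leaves m) (leaves_of m S1)" "leaves_of r S2 = {}"
      | "leaves_of l S0 = {}" "final_part (leaves m) (leaves_of m S1)" "initial_part (leaves r) (leaves_of r S2)"
      | "final_part (leaves l) (leaves_of l S0)" "leaves_of m S1 = set (leaves m)" "initial_part (leaves r) (leaves_of r S2)"
      using middle_part_Node3[of l m r, OF _ leaves_of_subset[of l S0] leaves_of_subset[of m S1] leaves_of_subset[of r S2]]
        Node3.prems(3) S(1) by auto
    then show ?thesis
    proof cases
      case 1
      then have "S1 = []" "S2 = []" using minimal_empty S by blast+
      then show ?thesis using Node3.IH(1)[OF g(2) S(2) 1(1)] S(1) by auto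
    next
      case 2
      then have "S0 = []" "S2 = []" using minimal_empty S by blast+
      then show ?thesis using Node3.IH(2)[OF g(3) S(3) 2(2)] S(1) by auto
    next
      case 3
      then have "S0 = []" "S1 = []" using minimal_empty S by blast+
      then show ?thesis using Node3.IH(3)[OF g(4) S(4) 3(3)] S(1) by auto
    next
      case 4
      then have "S2 = []" using minimal_empty S by blast
      then show ?thesis using final_part_heights[OF g(2) S(2) 4(1)] initial_part_heights[OF g(3) S(3) 4(2)] S(1)
        by - (rule exI[of _ "heights l S0"], rule exI[of _ "heights m S1"], simp)
    next
      case 5
      then have "S0 = []" using minimal_empty S by blast
      then show ?thesis using final_part_heights[OF g(3) S(3) 5(2)] initial_part_heights[OF g(4) S(4) 5(3)] S(1)
        by - (rule exI[of _ "heights m S1"], rule exI[of _ "heights r S2"], simp)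
    next
      case 6
      then have "S1 = [[]]" using minimal_all S by blast
      \<comment> \<open>The completely covered middle child is assigned to the left side. There it
        is the only tree of height \<open>g\<close>, or the second one if the left child is covered
        completely too.\<close>
      moreover have "staircase (heights l S0 @ [g])"
        using final_part_heights[OF g(2) S(2) 6(1)] full_height[OF g(2)] by (auto intro: staircase_snoc)
      ultimately show ?thesis using initial_part_heights[OF g(4) S(4) 6(3)] S(1) full_height[OF g(3)]
        by - (rule exI[of _ "heights l S0 @ [g]"], rule exI[of _ "heights r S2"], simp)
    qed
  qed
qed

section \<open>Heights against numbers of leaves\<close>

lemma card_Cons_image [simp]: "card ((#) x ` A) = card A"
  by (simp add: card_image)

lemma card_leaves: "full h T \<Longrightarrow> 2 ^ h \<le> card (set (leaves T))"
proof (induction T arbitrary: h)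
  case (Node2 l r)
  then obtain g where g: "h = Suc g" "full g l" "full g r" by auto
  have "card (set (leaves (Node2 l r))) = card (set (leaves l)) + card (set (leaves r))"
    by (simp, subst card_Un_disjoint) auto
  then show ?case using Node2.IH(1)[OF g(2)] Node2.IH(2)[OF g(3)] g(1) by simp
next
  case (Node3 l m r)
  then obtain g where g: "h = Suc g" "full g l" "full g r" by auto
  \<comment> \<open>Two children of height \<open>g\<close> already supply \<open>2 ^ Suc g\<close>
    leaves.\<close>
  have "card (set (leaves l)) + card (set (leaves r)) = card ((#) 0 ` set (leaves l) \<union> (#) 2 ` set (leaves r))"
    by (subst card_Un_disjoint) auto
  also have "\<dots> \<le> card (set (leaves (Node3 l m r)))" by (rule card_mono) auto
  finally show ?case using Node3.IH(1)[OF g(2)] Node3.IH(3)[OF g(3)] g(1) by simp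
qed auto

text \<open>The leaves are counted as positions in \<open>T\<close>, because \<open>k\<close> counts
  such positions; the bound then passes from a node to the slice by inclusion.\<close>

lemma subtree_full:
  "full h T \<Longrightarrow> p \<in> nodes T \<Longrightarrow> \<exists>g. full g (subtree T p) \<and> 2 ^ g \<le> card (leaves_below T p)"
proof (induction T arbitrary: h p)
  case (Leaf x)
  then show ?case by auto
next
  case (Node2 l r)
  show ?case
  proof (cases "p = []")
    case True
    then show ?thesis using card_leaves[OF Node2.prems(1)] Node2.prems(1) by (intro exI[of _ h]) simp
  next
    case False
    obtain g where g: "full g l" "full g r" using Node2.prems(1) by auto
    show ?thesis using False Node2.prems(2) Node2.IH(1)[OF g(1)] Node2.IH(2)[OF g(2)] by auto
  qed
next
  case (Node3 l m r)
  show ?case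
  proof (cases "p = []")
    case True
    then show ?thesis using card_leaves[OF Node3.prems(1)] Node3.prems(1) by (intro exI[of _ h]) simp
  next
    case False
    obtain g where g: "full g l" "full g m" "full g r" using Node3.prems(1) by auto
    show ?thesis using False Node3.prems(2) Node3.IH(1)[OF g(1)] Node3.IH(2)[OF g(2)] Node3.IH(3)[OF g(3)] by auto
  qed
qed

lemma ordered_slice_heights:
  assumes "full h T" "is_ordered_slice T S"
  shows "\<exists>us vs. heights T S = us @ vs \<and> staircase us \<and> staircase (rev vs)"
  using middle_part_heights[OF assms(1) ordered_slice_minimal[OF assms(2)]] assms(2)
  by (auto simp: is_ordered_slice_def is_slice_def consecutive_leaves_def middle_part_def)

text \<open>From \<open>k = 3\<close> on, \<open>ln k\<close> is at least 1 because
  \<open>exp 1\<close> is at most 3, so it absorbs the constant 2000. The summand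
  \<open>2000 / ln 2\<close> comes from the change of base.\<close>

lemma log_time_bigo: "(\<lambda>k. real (2000 * Suc (nat \<lfloor>log 2 (real k)\<rfloor>))) \<in> O(\<lambda>k. ln (real k))"
proof (rule bigoI[where c = "2000 + 2000 / ln 2"], rule eventually_mono[OF eventually_ge_at_top[of 3]])
  fix k :: nat assume k: "3 \<le> k"
  have "exp 1 \<le> real k" using exp_le k by linarith
  then have ln: "1 \<le> ln (real k)" using k by (simp add: ln_ge_iff)
  then have pos: "0 \<le> log 2 (real k)" using k by simp
  have "real (2000 * Suc (nat \<lfloor>log 2 (real k)\<rfloor>)) \<le> 2000 + 2000 * log 2 (real k)"
    using pos by simp
  also have "\<dots> \<le> 2000 * ln (real k) + 2000 / ln 2 * ln (real k)"
    using ln by (simp add: log_def)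
  finally show "norm (real (2000 * Suc (nat \<lfloor>log 2 (real k)\<rfloor>))) \<le> (2000 + 2000 / ln 2) * norm (ln (real k))"
    using ln by (simp add: distrib_right)
qed

theorem mainTheorem13:
  "\<exists>(prog :: com) (time :: nat \<Rightarrow> nat).
     (\<lambda>k. real (time k)) \<in> O(\<lambda>k. ln (real k)) \<and>
     (\<forall>(T :: 'a tree23) S (k :: nat) item s.
        is_tree23 T \<and> is_ordered_slice T S \<and> S \<noteq> [] \<and> card (leaves_of T S) = k \<and>
        slice_input item T S s \<longrightarrow>
        (\<exists>t s' T'. exec prog s t s' \<and> t \<le> time k \<and>
           is_tree23 T' \<and> items T' = concat (map (\<lambda>p. items (subtree T p)) S) \<and>
           tree_output item T' s'))"
proof (rule exI[of _ join_slice], rule exI[of _ "\<lambda>k. 2000 * Suc (nat \<lfloor>log 2 (real k)\<rfloor>)"], intro conjI allI impI)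
  show "(\<lambda>k. real (2000 * Suc (nat \<lfloor>log 2 (real k)\<rfloor>))) \<in> O(\<lambda>k. ln (real k))"
    by (rule log_time_bigo)
next
  fix T :: "'a tree23" and S k item s
  assume A: "is_tree23 T \<and> is_ordered_slice T S \<and> S \<noteq> [] \<and> card (leaves_of T S) = k \<and>
    slice_input item T S s"
  \<comment> \<open>Bounds the heights of the trees in the slice: a tree of height \<open>g\<close>
    has at least \<open>2 ^ g\<close> leaves, all counted in \<open>k\<close>. The height
    \<open>h\<close> of \<open>T\<close> does not enter the time.\<close>
  define H where "H = nat \<lfloor>log 2 (real k)\<rfloor>"
  define ts where "ts = map (subtree T) S"
  obtain h where h: "full h T" using A is_tree23_iff_full by blast
  have n: "set S \<subseteq> nodes T" using A ordered_slice_minimal[of T S] by (auto simp: minimal_def)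
  have fullH: "\<exists>g\<le>H. full g (subtree T p)" if p: "p \<in> set S" for p
  proof -
    obtain g where g: "full g (subtree T p)" "2 ^ g \<le> card (leaves_below T p)"
      using subtree_full[OF h] p n by blast
    have "leaves_below T p \<subseteq> leaves_of T S" using p by (auto simp: leaves_of_def)
    moreover have "finite (leaves_of T S)" using leaves_of_subset finite_subset by blast
    ultimately have "2 ^ g \<le> k" using g(2) A card_mono le_trans by blast
    then have "real g \<le> log 2 (real k)" by (rule le_log2_of_power)
    then have "g \<le> H" unfolding H_def by (rule le_nat_floor)
    then show ?thesis using g by blast
  qed
  obtain us vs where uv: "heights T S = us @ vs" "staircase us" "staircase (rev vs)"
    using ordered_slice_heights[OF h] A by blast
  have heights: "map height ts = us @ vs" using uv(1) by (simp add: ts_def heights_def comp_def)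
  obtain ts1 ts2 where ts: "ts = ts1 @ ts2" "map height ts1 = us" "map height ts2 = vs"
    using heights by (auto simp: map_eq_append_conv)
  have H: "\<forall>t \<in> set ts. \<exists>g\<le>H. full g t" using fullH by (auto simp: ts_def)
  have "\<forall>x \<in> set (us @ vs). x \<le> H"
    unfolding heights[symmetric] using H full_height by fastforce
  then have "length us \<le> 2 * Suc H" "length vs \<le> 2 * Suc H"
    using staircase_length[OF uv(2)] staircase_length[OF uv(3)] by auto
  then have len: "length ts \<le> 4 * Suc H" using arg_cong[OF heights, of length] by simp
  have inp: "regs s 1 = length ts" "regs s 0 + length ts \<le> regs s 2" "ts \<noteq> []"
    "\<forall>i < length ts. stored (mem s) item (regs s 2) (mem s (regs s 0 + i)) (ts ! i)"
    using A by (auto simp: slice_input_def ts_def)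
  obtain s' T' h' where r: "run join_slice (2000 * Suc H) s s'" "full h' T'" "items T' = concat (map items ts)"
    "stored (mem s') item (regs s' 2) (regs s' 0) T'"
    using join_slice_run[OF inp H ts(1) _ _ len] uv ts by blast
  then show "\<exists>t s' T'. exec join_slice s t s' \<and> t \<le> 2000 * Suc (nat \<lfloor>log 2 (real k)\<rfloor>) \<and>
    is_tree23 T' \<and> items T' = concat (map (\<lambda>p. items (subtree T p)) S) \<and> tree_output item T' s'"
    unfolding run_def H_def tree_output_def is_tree23_iff_full ts_def by (auto simp: comp_def)
qed

end
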